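(* Let $X$ be a nonempty compact metric space and let $T\colon X \to X$ be a continuous transformation. Let $\mathfrak{X}$ be a real vector space of continuous functions $X \to \mathbb{R}$ equipped with a complete metric with respect to which translation and scalar multiplication are both continuous, and such that $\mathfrak{X}$ is dense as a subset of $C(X)$. Then the set $$\left\{f \in \mathfrak{X} \colon \mathcal{M}_{\max}(f)\text{ is a singleton}\right\}$$ is a prevalent subset of $\mathfrak{X}$.
   Context: $C(X)$ denotes the space of continuous functions $X \to \mathbb{R}$ with the supremum norm. $\mathcal{M}_T$ denotes the set of all $T$-invariant Borel probability measures on $X$. It is nonempty, and it is compact and metrisable in the weak-* topology, i.e. the smallest topology on $\mathcal{M}_T$ such that $\mu \mapsto \int f\,d\mu$ is continuous for every $f \in C(X)$. For $f \in C(X)$ define $\beta(f) := \sup_{\mu \in \mathcal{M}_T} \int f\,d\mu$, and let $\mathcal{M}_{\max}(f)$ denote the set of all $\mu \in \mathcal{M}_T$ such that $\int f\,d\mu = \beta(f)$ (the maximising measures of $f$). Prevalence: if $\mathfrak{X}$ is a topological vector space equipped with a complete metric, a subset $\mathcal{P}$ of $\mathfrak{X}$ is called prevalent if there exists a compactly supported Borel probability measure $m$ on $\mathfrak{X}$ such that for every $x \in \mathfrak{X}$ the translated set $x + \mathcal{P}$ has full measure with respect to $m$.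
   Formalization: The formal theorem additionally assumes that the inclusion of 𝔛 (with its complete metric) into C(X) is continuous; without this link between the metric and the functions the claim fails, e.g. for C(Hilbert cube), T = id, with a topology carried over from ℓ² by a suitable linear bijection. *)

theory Defs
  imports "HOL-Probability.Probability"
begin

text \<open>
  Throughout, \<open>X\<close> is the universe of a (compact) metric space type \<open>'a\<close>, so that the type
  \<^typ>\<open>'a \<Rightarrow>\<^sub>C real\<close> of bounded continuous functions, with its supremum norm, is \<open>C(X)\<close>.
\<close>

definition invariant_measures :: "('a::metric_space \<Rightarrow> 'a) \<Rightarrow> 'a measure set" where
  "invariant_measures T =
     {\<mu>. prob_space \<mu> \<and> sets \<mu> = sets borel \<and>
         (\<forall>A\<in>sets borel. emeasure \<mu> (T -` A) = emeasure \<mu> A)}"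

definition max_ergodic_average :: "('a::metric_space \<Rightarrow> 'a) \<Rightarrow> ('a \<Rightarrow>\<^sub>C real) \<Rightarrow> real" where
  "max_ergodic_average T f = (SUP \<mu>\<in>invariant_measures T. \<integral>x. apply_bcontfun f x \<partial>\<mu>)"

definition maximising_measures ::
    "('a::metric_space \<Rightarrow> 'a) \<Rightarrow> ('a \<Rightarrow>\<^sub>C real) \<Rightarrow> 'a measure set" where
  "maximising_measures T f =
     {\<mu> \<in> invariant_measures T. (\<integral>x. apply_bcontfun f x \<partial>\<mu>) = max_ergodic_average T f}"

text \<open>
  The ambient vector space is \<^term>\<open>topspace \<tau>\<close>, a linear subspace of \<open>'b\<close> whose topology
  need not be the one inherited from \<open>'b\<close>; hence the Borel sets are generated explicitly from
  the open sets of \<open>\<tau>\<close>. Full measure means that the complement is contained in a null set.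
\<close>

definition prevalent :: "'b::ab_group_add topology \<Rightarrow> 'b set \<Rightarrow> bool" where
  "prevalent \<tau> P \<longleftrightarrow>
     P \<subseteq> topspace \<tau> \<and>
     (\<exists>m. prob_space m \<and>
          space m = topspace \<tau> \<and> sets m = sets (sigma (topspace \<tau>) {U. openin \<tau> U}) \<and>
          (\<exists>K. compactin \<tau> K \<and> emeasure m K = 1) \<and>
          (\<forall>x\<in>topspace \<tau>. AE y in m. y \<in> (+) x ` P))"

end

theory Submission
  imports Defs
begin

text \<open>
The function \<open>\<beta> = max_ergodic_average T\<close> is a supremum of linear functionals, hence convex, and a
maximising measure of \<open>h\<close> is a subgradient of \<open>\<beta>\<close> at \<open>h\<close>. If \<open>\<beta>\<close> is differentiable at \<open>h\<close> in the
direction \<open>g\<close>, then all maximising measures of \<open>h\<close> give \<open>g\<close> the same integral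
(\<open>maximising_integral_unique\<close>). So \<open>h\<close> has a unique maximising measure as soon as \<open>\<beta>\<close> is
differentiable at \<open>h\<close> along each member of a sequence \<open>g n\<close> whose integrals determine a measure;
such a sequence exists inside the dense space \<open>V\<close> (\<open>determining_sequence_in_dense\<close>). A convex
function of one real variable fails to be differentiable at only countably many points, so on each
line in direction \<open>g\<close> the exceptional functions are countable
(\<open>countable_nondifferentiable_on_line\<close>).

The measure that witnesses prevalence is the law of the random series
\<open>\<Sum>n. (t n * a n) *\<^sub>R g n\<close>, where the \<open>t n\<close> are independent and uniform on \<open>[0, 1]\<close>, and the \<open>a n\<close> are
positive and so small that the series converges uniformly in \<open>t\<close> for the metric of \<open>V\<close>
(\<open>uniformly_convergent_random_series\<close>). The sum is continuous on the compact cube, so its law has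
compact support. A translate of the series is affine in each coordinate \<open>t n\<close>, with direction a
multiple of \<open>g n\<close>. By Fubini the line statement shows that almost surely \<open>\<beta>\<close> is differentiable
along every \<open>g n\<close>.

Two points need work. First, the existence of invariant and of maximising measures rests on the
sequential compactness of the probability measures on \<open>X\<close> (\<open>prob_measures_seq_compact\<close>). It is
reduced to Helly's selection theorem on the real line: an injective Borel code maps \<open>X\<close> into the
reals with uniformly continuous inverse, and weak limits of the coded measures are transported back.
Secondly, addition on \<open>V\<close> is only assumed to be continuous in each argument separately, while partial
sums of the series must be jointly continuous in their coefficients. Baire's theorem on the real
line gives one point of joint continuity, and translations carry it to all others
(\<open>continuous_map_add_scaleR\<close>).
\<close>

section \<open>Countable families of functions that determine a measure\<close>

text \<open>
A compact space has a finite \<open>1/(n+1)\<close>-net for every \<open>n\<close>; the balls listed are those of all these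
nets. The bound \<open>N\<close>, uniform in the point \<open>x\<close>, is what later makes the inverse of the code uniformly
continuous.
\<close>

lemma compact_countable_fine_balls:
  assumes "compact (UNIV :: 'a::metric_space set)"
  shows "\<exists>(c :: nat \<Rightarrow> 'a) (\<rho> :: nat \<Rightarrow> real).
    \<forall>e>0. \<exists>N. \<forall>x. \<exists>i<N. dist (c i) x < \<rho> i \<and> \<rho> i < e"
proof -
  have "\<exists>k. finite k \<and> (\<forall>x::'a. \<exists>y\<in>k. dist y x < 1 / real (Suc n))" for n
    using seq_compact_imp_totally_bounded[OF assms[unfolded compact_eq_seq_compact_metric]]
    by (auto simp: subset_eq mem_ball dest!: spec[of _ "1 / real (Suc n)"])
  then obtain K :: "nat \<Rightarrow> 'a set"
    where K: "\<And>n. finite (K n)" "\<And>n x. \<exists>y\<in>K n. dist y x < 1 / real (Suc n)"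
    by metis
  define D where "D = (\<Union>n. K n \<times> {1 / real (Suc n)})"
  have D: "countable D"
    unfolding D_def by (rule countable_UN) (simp_all add: countable_finite K(1))
  define c where "c i = fst (from_nat_into D i)" for i
  define \<rho> where "\<rho> i = snd (from_nat_into D i)" for i
  show ?thesis
  proof (intro exI[of _ c] exI[of _ \<rho>] allI impI)
    show "\<exists>N. \<forall>x. \<exists>i<N. dist (c i) x < \<rho> i \<and> \<rho> i < e" if e: "0 < e" for e
    proof -
      obtain n where n: "1 / real (Suc n) < e"
        using nat_approx_posE[OF e] by blast
      define N where "N = Suc (Max ((\<lambda>y. to_nat_on D (y, 1 / real (Suc n))) ` K n))"
      have "\<exists>i<N. dist (c i) x < \<rho> i \<and> \<rho> i < e" for x
      proof -
        obtain y where y: "y \<in> K n" "dist y x < 1 / real (Suc n)"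
          using K(2) by blast
        then have "(y, 1 / real (Suc n)) \<in> D"
          by (auto simp: D_def)
        moreover have "to_nat_on D (y, 1 / real (Suc n)) < N"
          using y K(1) by (auto simp: N_def less_Suc_eq_le)
        ultimately show ?thesis
          using y n D by (intro exI[of _ "to_nat_on D (y, 1 / real (Suc n))"]) (simp add: c_def \<rho>_def)
      qed
      then show ?thesis by blast
    qed
  qed
qed

text \<open>
Finite intersections of the balls above form a countable basis that is stable under intersection,
so a measure is determined by its values on them. The indicator of such an intersection is the
increasing limit of the functions \<open>min 1 (k * w)\<close>, where \<open>w\<close> is a continuous function that is positive
exactly there.
\<close>

lemma countable_determining_functions:
  assumes "compact (UNIV :: 'a::metric_space set)"
  shows "\<exists>\<phi> :: nat \<Rightarrow> 'a \<Rightarrow>\<^sub>C real. \<forall>\<mu> \<nu>. prob_space \<mu> \<longrightarrow> sets \<mu> = sets borel \<longrightarrow>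
    prob_space \<nu> \<longrightarrow> sets \<nu> = sets borel \<longrightarrow>
    (\<forall>n. (\<integral>x. \<phi> n x \<partial>\<mu>) = (\<integral>x. \<phi> n x \<partial>\<nu>)) \<longrightarrow> \<mu> = \<nu>"
proof -
  obtain c :: "nat \<Rightarrow> 'a" and \<rho>
    where fine: "\<And>e. 0 < e \<Longrightarrow> \<exists>N. \<forall>x. \<exists>i<N. dist (c i) x < \<rho> i \<and> \<rho> i < e"
    using compact_countable_fine_balls[OF assms] by blast
  define w where "w F x = (\<Prod>i\<leftarrow>F. max 0 (\<rho> i - dist (c i) x))" for F x
  define U where "U F = {x. \<forall>i\<in>set F. dist (c i) x < \<rho> i}" for F
  have w_pos: "0 < w F x \<longleftrightarrow> x \<in> U F" and w_nonneg: "0 \<le> w F x" for F x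
    by (induction F) (auto simp: w_def U_def zero_less_mult_iff)
  have w_cont: "continuous_on UNIV (w F)" for F
    unfolding w_def by (induction F) (auto intro!: continuous_intros)
  define \<psi> where "\<psi> F k = Bcontfun (\<lambda>x. min 1 (real k * w F x))" for F k
  have \<psi>: "apply_bcontfun (\<psi> F k) = (\<lambda>x. min 1 (real k * w F x))" for F k
    unfolding \<psi>_def
    by (intro Bcontfun_inverse bcontfun_normI[where b = 1] continuous_intros w_cont)
       (auto simp: w_nonneg)
  have lim: "(\<lambda>k. \<integral>x. \<psi> F k x \<partial>\<mu>) \<longlonglongrightarrow> measure \<mu> (U F)"
    if "prob_space \<mu>" and s: "sets \<mu> = sets borel" for \<mu> F
  proof -
    interpret prob_space \<mu> by fact
    have [measurable_cong]: "sets \<mu> = sets borel" by fact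
    have [measurable]: "w F \<in> borel_measurable borel"
      by (intro borel_measurable_continuous_onI w_cont)
    have "U F = {x\<in>space borel. 0 < w F x}"
      by (simp add: w_pos)
    also have "\<dots> \<in> sets borel"
      by measurable
    finally have [measurable]: "U F \<in> sets borel" .
    have pw: "(\<lambda>k. min 1 (real k * w F x)) \<longlonglongrightarrow> indicator (U F) x" for x
    proof (cases "x \<in> U F")
      case True
      then have "0 < w F x" by (simp add: w_pos)
      then obtain k0 :: nat where "1 < real k0 * w F x"
        using reals_Archimedean3 by blast
      then have "1 \<le> real k * w F x" if "k0 \<le> k" for k
        using that mult_right_mono[of "real k0" "real k" "w F x"] w_nonneg[of F x] by simp
      then have "\<forall>\<^sub>F k in sequentially. min 1 (real k * w F x) = indicator (U F) x"
        using True unfolding eventually_sequentially by (intro exI[of _ k0]) auto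
      then show ?thesis by (rule tendsto_eventually)
    next
      case False
      then have "w F x = 0" using w_nonneg[of F x] w_pos[of F x] by simp
      then show ?thesis using False by simp
    qed
    have "(\<lambda>k. \<integral>x. \<psi> F k x \<partial>\<mu>) \<longlonglongrightarrow> (\<integral>x. indicator (U F) x \<partial>\<mu>)"
      unfolding \<psi>
      by (rule integral_dominated_convergence[where w = "\<lambda>_. 1"]) (auto simp: pw w_nonneg)
    then show ?thesis
      using sets_eq_imp_space_eq[OF s] by simp
  qed
  have basis: "topological_basis (range U)"
  proof (rule topological_basisI)
    show "open B" if B: "B \<in> range U" for B
    proof -
      obtain F where F: "B = U F" using B by blast
      have "U F = (\<Inter>i\<in>set F. ball (c i) (\<rho> i))"
        by (auto simp: U_def)
      then show ?thesis by (simp add: F open_INT)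
    qed
    show "\<exists>B\<in>range U. x \<in> B \<and> B \<subseteq> O'" if O: "open O'" "x \<in> O'" for O' x
    proof -
      obtain e where e: "0 < e" "ball x e \<subseteq> O'"
        using O by (auto simp: open_contains_ball)
      obtain i where i: "dist (c i) x < \<rho> i" "\<rho> i < e / 2"
        using fine[of "e / 2"] e by auto
      have "U [i] \<subseteq> ball x e"
      proof
        fix y assume "y \<in> U [i]"
        then show "y \<in> ball x e"
          using i dist_triangle2[of x y "c i"] by (simp add: U_def dist_commute)
      qed
      then show ?thesis
        using i e by (intro bexI[of _ "U [i]"] conjI rangeI) (auto simp: U_def)
    qed
  qed
  have "borel = sigma UNIV (range U)"
    by (rule borel_eq_countable_basis[OF _ basis]) auto
  then have "sets borel = sets (sigma UNIV (range U))"
    by (rule arg_cong)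
  also have "\<dots> = sigma_sets UNIV (range U)"
    by (rule sets_measure_of) simp
  finally have gen: "sets borel = sigma_sets UNIV (range U)" .
  show ?thesis
  proof (intro exI[of _ "\<lambda>n. case_prod \<psi> (from_nat n)"] allI impI)
    fix \<mu> \<nu> :: "'a measure"
    assume *: "prob_space \<mu>" "sets \<mu> = sets borel" "prob_space \<nu>" "sets \<nu> = sets borel"
      and eq: "\<forall>n. (\<integral>x. case_prod \<psi> (from_nat n) x \<partial>\<mu>) = (\<integral>x. case_prod \<psi> (from_nat n) x \<partial>\<nu>)"
    interpret \<mu>: prob_space \<mu> by fact
    interpret \<nu>: prob_space \<nu> by fact
    have "(\<integral>x. \<psi> F k x \<partial>\<mu>) = (\<integral>x. \<psi> F k x \<partial>\<nu>)" for F k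
      using eq[rule_format, of "to_nat (F, k)"] by simp
    then have U_eq: "measure \<mu> (U F) = measure \<nu> (U F)" for F
      using lim[of \<mu> F] lim[of \<nu> F] * LIMSEQ_unique by auto
    show "\<mu> = \<nu>"
    proof (rule measure_eqI_generator_eq[where E = "range U" and \<Omega> = UNIV and A = "\<lambda>_. UNIV"])
      show "Int_stable (range U)"
      proof (rule Int_stableI)
        fix a b assume "a \<in> range U" "b \<in> range U"
        then obtain F G where "a = U F" "b = U G" by blast
        then have "a \<inter> b = U (F @ G)" by (auto simp: U_def)
        then show "a \<inter> b \<in> range U" by blast
      qed
      have "U [] = UNIV" by (simp add: U_def)
      then show "range (\<lambda>_::nat. UNIV) \<subseteq> range U" by (metis UNIV_I image_subsetI rangeI)
    qed (use gen * U_eq in \<open>auto simp: \<mu>.emeasure_eq_measure \<nu>.emeasure_eq_measure\<close>)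
  qed
qed

section \<open>Sequential compactness of the probability measures\<close>

text \<open>
Two sequences of digits 0 and 1 that first differ at place \<open>j\<close> have ternary values at least
\<open>(1/3)^j / 2\<close> apart, because the later digits contribute at most \<open>(1/3)^j / 2\<close>. Base 3 leaves gaps
that base 2 would not.
\<close>

lemma ternary_code_gap:
  fixes a b :: "nat \<Rightarrow> bool"
  assumes "i < N" and "a i \<noteq> b i"
  shows "(1/3) ^ N \<le> \<bar>(\<Sum>i. of_bool (a i) * (1/3) ^ i) - (\<Sum>i. of_bool (b i) * (1/3) ^ i) :: real\<bar>"
proof -
  define j where "j = (LEAST j. a j \<noteq> b j)"
  have j: "a j \<noteq> b j" and j_least: "\<And>k. k < j \<Longrightarrow> a k = b k" and "j \<le> i"
    unfolding j_def using assms LeastI[of "\<lambda>j. a j \<noteq> b j"] not_less_Least[of _ "\<lambda>j. a j \<noteq> b j"]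
      Least_le[of "\<lambda>j. a j \<noteq> b j"] by blast+
  define t where "t k = (of_bool (a k) - of_bool (b k)) * (1/3::real) ^ k" for k
  have t_eq: "t = (\<lambda>k. of_bool (a k) * (1/3) ^ k - of_bool (b k) * (1/3) ^ k)"
    by (simp add: t_def left_diff_distrib fun_eq_iff)
  have t_le: "norm (t k) \<le> (1/3) ^ k" for k
    by (cases "a k"; cases "b k") (simp_all add: t_def)
  have summable_geom: "summable (\<lambda>k. (1/3::real) ^ (k + m))" for m
    by (intro summable_ignore_initial_segment summable_geometric) simp
  have sm: "summable (\<lambda>k. of_bool (p k) * (1/3::real) ^ k)" for p
    by (rule summable_comparison_test'[where N=0, OF summable_geom[of 0]]) auto
  have st: "summable t"
    by (rule summable_comparison_test'[where N=0, OF summable_geom[of 0]]) (use t_le in auto)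
  have st': "summable (\<lambda>k. norm (t (k + Suc j)))"
    by (rule summable_comparison_test'[where N=0, OF summable_geom[of "Suc j"]]) (simp only: real_norm_def abs_abs t_le[unfolded real_norm_def])
  have "(\<Sum>i. of_bool (a i) * (1/3) ^ i) - (\<Sum>i. of_bool (b i) * (1/3) ^ i) = suminf t"
    by (simp only: suminf_diff[OF sm sm] t_eq)
  also have "\<dots> = (\<Sum>k. t (k + Suc j)) + (\<Sum>k<Suc j. t k)"
    by (rule suminf_split_initial_segment[OF st])
  also have "(\<Sum>k<Suc j. t k) = t j"
    using j_least by (auto simp: t_def)
  finally have eq: "(\<Sum>i. of_bool (a i) * (1/3) ^ i) - (\<Sum>i. of_bool (b i) * (1/3) ^ i)
    = (\<Sum>k. t (k + Suc j)) + t j" .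
  have "\<bar>\<Sum>k. t (k + Suc j)\<bar> \<le> (\<Sum>k. norm (t (k + Suc j)))"
    using summable_norm[OF st'] by simp
  also have "\<dots> \<le> (\<Sum>k. (1/3) ^ (k + Suc j))"
    by (intro suminf_le t_le st' summable_geom)
  also have "\<dots> = (\<Sum>k. (1/3) ^ k * (1/3) ^ Suc j)"
    by (simp add: power_add)
  also have "\<dots> = (\<Sum>k. (1/3) ^ k) * (1/3) ^ Suc j"
    by (rule suminf_mult2[symmetric]) (simp add: summable_geometric)
  also have "\<dots> = (1/3) ^ j / 2"
    by (simp add: suminf_geometric)
  finally have "\<bar>\<Sum>k. t (k + Suc j)\<bar> \<le> (1/3) ^ j / 2" .
  moreover have "\<bar>t j\<bar> = (1/3) ^ j"
    using j by (cases "a j"; cases "b j") (auto simp: t_def)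
  ultimately have "(1/3) ^ j / 2 \<le> \<bar>(\<Sum>k. t (k + Suc j)) + t j\<bar>"
    by linarith
  moreover have "(1/3::real) ^ N \<le> (1/3) ^ Suc j"
    using \<open>j \<le> i\<close> \<open>i < N\<close> by (intro power_decreasing) auto
  moreover have "(0::real) < (1/3) ^ j" by simp
  ultimately show ?thesis
    unfolding eq power_Suc by linarith
qed

text \<open>
The code of a point lists, as ternary digits, which of the countably many balls contain it. It is
usually discontinuous, but close codes agree on many digits, so their points lie in a common small
ball.
\<close>

lemma compact_real_code:
  assumes "compact (UNIV :: 'a::metric_space set)"
  obtains s :: "'a::metric_space \<Rightarrow> real"
  where "s \<in> borel_measurable borel" and "range s \<subseteq> {0..2}"
    and "\<And>e. 0 < e \<Longrightarrow> \<exists>\<delta>>0. \<forall>x y. \<bar>s x - s y\<bar> < \<delta> \<longrightarrow> dist x y < e"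
proof -
  obtain c :: "nat \<Rightarrow> 'a" and \<rho>
    where fine: "\<And>e. 0 < e \<Longrightarrow> \<exists>N. \<forall>x. \<exists>i<N. dist (c i) x < \<rho> i \<and> \<rho> i < e"
    using compact_countable_fine_balls[OF assms] by blast
  define s where "s x = (\<Sum>i. of_bool (dist (c i) x < \<rho> i) * (1/3) ^ i :: real)" for x
  have geom: "summable (\<lambda>i. (1/3::real) ^ i)"
    by (simp add: summable_geometric)
  have sm: "summable (\<lambda>k. of_bool (p k) * (1/3::real) ^ k)" for p
    by (rule summable_comparison_test'[where N=0, OF geom]) auto
  show ?thesis
  proof
    have "(\<lambda>x. of_bool (dist (c i) x < \<rho> i) * (1/3) ^ i :: real) \<in> borel_measurable borel" for i
    proof -
      have "(\<lambda>x. of_bool (dist (c i) x < \<rho> i) * (1/3) ^ i :: real)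
        = (\<lambda>x. indicator (ball (c i) (\<rho> i)) x * (1/3) ^ i)"
        by (auto simp: indicator_def)
      also have "\<dots> \<in> borel_measurable borel"
        by (intro borel_measurable_times borel_measurable_const borel_measurable_indicator) simp
      finally show ?thesis .
    qed
    then show "s \<in> borel_measurable borel"
      unfolding s_def by (rule borel_measurable_suminf)
    show "range s \<subseteq> {0..2}"
    proof clarsimp
      fix x
      have "s x \<le> (\<Sum>i. (1/3) ^ i)"
        unfolding s_def by (rule suminf_le[OF _ sm geom]) auto
      also have "\<dots> \<le> 2" by (simp add: suminf_geometric)
      finally show "0 \<le> s x \<and> s x \<le> 2"
        by (auto simp: s_def intro!: suminf_nonneg sm)
    qed
    show "\<exists>\<delta>>0. \<forall>x y. \<bar>s x - s y\<bar> < \<delta> \<longrightarrow> dist x y < e" if e: "0 < e" for e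
    proof -
      obtain N where N: "\<And>x. \<exists>i<N. dist (c i) x < \<rho> i \<and> \<rho> i < e / 2"
        using fine[of "e / 2"] e by auto
      have "dist x y < e" if xy: "\<bar>s x - s y\<bar> < (1/3) ^ N" for x y
      proof -
        obtain i where i: "i < N" "dist (c i) x < \<rho> i" "\<rho> i < e / 2"
          using N by blast
        have "dist (c i) y < \<rho> i"
          using ternary_code_gap[of i N "\<lambda>i. dist (c i) x < \<rho> i" "\<lambda>i. dist (c i) y < \<rho> i"] i xy
          by (force simp: s_def)
        then show ?thesis
          using i dist_triangle2[of x y "c i"] by (simp add: dist_commute)
      qed
      then show ?thesis by (intro exI[of _ "(1/3) ^ N"]) auto
    qed
  qed
qed

text \<open>
The inverse of the code is uniformly continuous and takes values in a compact space, so it extends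
continuously to the closure of the range. The value at \<open>k\<close> is the limit of any convergent sequence of
points whose codes tend to \<open>k\<close>.
\<close>

lemma decode_real_code:
  fixes s :: "'a::metric_space \<Rightarrow> real"
  assumes "compact (UNIV :: 'a set)"
    and code: "\<And>e. 0 < e \<Longrightarrow> \<exists>\<delta>>0. \<forall>x y. \<bar>s x - s y\<bar> < \<delta> \<longrightarrow> dist x y < e"
  shows "\<exists>\<pi>. continuous_on (closure (range s)) \<pi> \<and> (\<forall>x. \<pi> (s x) = x)"
proof -
  have "\<exists>p. \<forall>e>0. \<exists>\<delta>>0. \<forall>x. \<bar>s x - k\<bar> < \<delta> \<longrightarrow> dist x p < e" if k: "k \<in> closure (range s)" for k
  proof -
    obtain u where u: "\<forall>n. u n \<in> range s" "u \<longlonglongrightarrow> k"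
      using k by (auto simp: closure_sequential)
    define y where "y n = inv s (u n)" for n
    have y: "u n = s (y n)" for n
      unfolding y_def by (rule f_inv_into_f[symmetric]) (use u(1) in blast)
    have "\<exists>p r. strict_mono r \<and> (y \<circ> r) \<longlonglongrightarrow> p"
      using assms(1) by (auto simp: compact_eq_seq_compact_metric seq_compact_def)
    then obtain p r where r: "strict_mono r" "(y \<circ> r) \<longlonglongrightarrow> p"
      by blast
    have lim: "(\<lambda>n. s (y (r n))) \<longlonglongrightarrow> k"
      using LIMSEQ_subseq_LIMSEQ[OF u(2) r(1)] by (simp add: y comp_def)
    have "\<exists>\<delta>>0. \<forall>x. \<bar>s x - k\<bar> < \<delta> \<longrightarrow> dist x p < e" if e: "0 < e" for e
    proof -
      obtain \<delta> where \<delta>: "0 < \<delta>" "\<And>x y. \<bar>s x - s y\<bar> < \<delta> \<Longrightarrow> dist x y < e / 2"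
        using code[of "e / 2"] e by auto
      have "\<forall>\<^sub>F n in sequentially. dist (s (y (r n))) k < \<delta> / 2"
        by (rule tendstoD[OF lim]) (use \<delta>(1) in simp)
      moreover have "\<forall>\<^sub>F n in sequentially. dist (y (r n)) p < e / 2"
        using tendstoD[OF r(2), of "e / 2"] e by (simp add: comp_def)
      ultimately have "\<forall>\<^sub>F n in sequentially. dist (s (y (r n))) k < \<delta> / 2 \<and> dist (y (r n)) p < e / 2"
        by (rule eventually_conj)
      then obtain n where n: "\<bar>s (y (r n)) - k\<bar> < \<delta> / 2" "dist (y (r n)) p < e / 2"
        by (auto simp: eventually_sequentially dist_real_def)
      have "dist x p < e" if "\<bar>s x - k\<bar> < \<delta> / 2" for x
        using \<delta>(2)[of x "y (r n)"] that n dist_triangle[of x p "y (r n)"] by linarith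
      then show ?thesis using \<delta>(1) by (intro exI[of _ "\<delta> / 2"]) auto
    qed
    then show ?thesis by blast
  qed
  then obtain \<pi> where \<pi>: "\<And>k e. k \<in> closure (range s) \<Longrightarrow> 0 < e
      \<Longrightarrow> \<exists>\<delta>>0. \<forall>x. \<bar>s x - k\<bar> < \<delta> \<longrightarrow> dist x (\<pi> k) < e"
    by metis
  show ?thesis
  proof (intro exI[of _ \<pi>] conjI allI)
    show "continuous_on (closure (range s)) \<pi>"
      unfolding continuous_on_iff
    proof (intro ballI allI impI)
      fix k and e :: real
      assume k: "k \<in> closure (range s)" and "0 < e"
      then obtain \<delta> where \<delta>: "0 < \<delta>" "\<And>x. \<bar>s x - k\<bar> < \<delta> \<Longrightarrow> dist x (\<pi> k) < e / 2"
        using \<pi>[of k "e / 2"] by auto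
      have "dist (\<pi> k') (\<pi> k) < e" if k': "k' \<in> closure (range s)" "dist k' k < \<delta> / 2" for k'
      proof -
        obtain \<delta>' where \<delta>': "0 < \<delta>'" "\<And>x. \<bar>s x - k'\<bar> < \<delta>' \<Longrightarrow> dist x (\<pi> k') < e / 2"
          using \<pi>[of k' "e / 2"] k' \<open>0 < e\<close> by auto
        obtain x where x: "dist (s x) k' < min \<delta>' (\<delta> / 2)"
          using k'(1) \<delta>' \<delta> unfolding closure_approachable
          by (metis (no_types, lifting) half_gt_zero min_less_iff_conj rangeE)
        then have "\<bar>s x - k'\<bar> < \<delta>'" "\<bar>s x - k\<bar> < \<delta>"
          using k'(2) unfolding dist_real_def by linarith+
        then have "dist x (\<pi> k') < e / 2" "dist x (\<pi> k) < e / 2"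
          using \<delta>(2)[of x] \<delta>'(2)[of x] by blast+
        then show ?thesis
          using dist_triangle3[of "\<pi> k'" "\<pi> k" x] by linarith
      qed
      then show "\<exists>d>0. \<forall>x'\<in>closure (range s). dist x' k < d \<longrightarrow> dist (\<pi> x') (\<pi> k) < e"
        using \<delta>(1) by (intro exI[of _ "\<delta> / 2"]) auto
    qed
    show "\<pi> (s x) = x" for x
    proof (rule ccontr)
      assume "\<pi> (s x) \<noteq> x"
      then have "0 < dist x (\<pi> (s x))" by simp
      moreover have "s x \<in> closure (range s)"
        by (rule subsetD[OF closure_subset rangeI])
      ultimately obtain \<delta> where "0 < \<delta>"
          "\<And>y. \<bar>s y - s x\<bar> < \<delta> \<Longrightarrow> dist y (\<pi> (s x)) < dist x (\<pi> (s x))"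
        using \<pi>[of "s x" "dist x (\<pi> (s x))"] by blast
      from this(2)[of x] this(1) show False
        by simp
    qed
  qed
qed

text \<open>
The coded measures live on a bounded interval, so Helly's theorem gives a subsequence that converges
weakly to some \<open>N\<close> on the real line. The limit is carried by the closure \<open>K\<close> of the codes, where the
decoding map \<open>\<pi>\<close> is continuous; the wanted limit is the image of \<open>N\<close> under \<open>\<pi>\<close>. Convergence against
\<open>f\<close> follows by testing with a continuous extension of \<open>f \<circ> \<pi>\<close> to the whole line.
\<close>

lemma prob_measures_seq_compact:
  fixes \<mu> :: "nat \<Rightarrow> 'a::metric_space measure"
  assumes compact: "compact (UNIV :: 'a set)"
    and "\<And>n. prob_space (\<mu> n)" and sets_\<mu>: "\<And>n. sets (\<mu> n) = sets borel"
  obtains r M where "strict_mono r" and "prob_space M" and "sets M = sets borel"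
    and "\<And>f :: 'a \<Rightarrow>\<^sub>C real. (\<lambda>n. \<integral>x. f x \<partial>\<mu> (r n)) \<longlonglongrightarrow> (\<integral>x. f x \<partial>M)"
proof -
  obtain s :: "'a \<Rightarrow> real"
    where s_meas: "s \<in> borel_measurable borel" and s_range: "range s \<subseteq> {0..2}"
      and code: "\<And>e. 0 < e \<Longrightarrow> \<exists>\<delta>>0. \<forall>x y. \<bar>s x - s y\<bar> < \<delta> \<longrightarrow> dist x y < e"
    by (rule compact_real_code[OF compact], rule that, blast+)
  obtain \<pi> where \<pi>: "continuous_on (closure (range s)) \<pi>" "\<And>x. \<pi> (s x) = x"
    using decode_real_code[OF compact code] by blast
  define K where "K = closure (range s)"
  have K: "closed K" "range s \<subseteq> K" "continuous_on K \<pi>"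
    using \<pi>(1) by (auto simp: K_def closure_subset[THEN subsetD])
  interpret \<mu>: prob_space "\<mu> n" for n by fact
  note [measurable_cong] = sets_\<mu>
  note [measurable] = s_meas
  have space_\<mu>: "space (\<mu> n) = UNIV" for n
    using sets_eq_imp_space_eq[OF sets_\<mu>] by simp
  define \<nu> where "\<nu> n = distr (\<mu> n) borel s" for n
  have real_\<nu>: "real_distribution (\<nu> n)" for n
    unfolding \<nu>_def by (rule \<mu>.real_distribution_distr) measurable
  have "tight \<nu>"
    unfolding tight_def
  proof (intro conjI allI impI real_\<nu>)
    fix \<epsilon> :: real assume "0 < \<epsilon>"
    have "measure (\<nu> n) {-1<..2} = 1" for n
    proof -
      have "s -` {-1<..2} = UNIV" using s_range by force
      then have "measure (\<nu> n) {-1<..2} = measure (\<mu> n) UNIV"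
        by (simp add: \<nu>_def measure_distr space_\<mu>)
      then show ?thesis using \<mu>.prob_space[of n] by (simp add: space_\<mu>)
    qed
    then show "\<exists>a b. a < b \<and> (\<forall>n. 1 - \<epsilon> < measure (\<nu> n) {a<..b})"
      using \<open>0 < \<epsilon>\<close> by (intro exI[of _ "-1"] exI[of _ 2]) auto
  qed
  then obtain r N where r: "strict_mono r" and N: "real_distribution N"
    and conv: "weak_conv_m (\<nu> \<circ> r) N"
    using tight_imp_convergent_subsubsequence[of \<nu> id] by (auto simp: strict_mono_def)
  interpret N: real_distribution N by fact
  have lim: "(\<lambda>n. \<integral>x. h (s x) \<partial>\<mu> (r n)) \<longlonglongrightarrow> (\<integral>y. h y \<partial>N)"
    if h: "continuous_on UNIV h" "\<And>y. \<bar>h y\<bar> \<le> B" for h :: "real \<Rightarrow> real" and B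
  proof -
    have [measurable]: "h \<in> borel_measurable borel"
      by (intro borel_measurable_continuous_onI h)
    have "(\<lambda>n. \<integral>y. h y \<partial>(\<nu> \<circ> r) n) \<longlonglongrightarrow> (\<integral>y. h y \<partial>N)"
      by (rule weak_conv_imp_integral_bdd_continuous_conv[where B = B])
         (use h real_\<nu> N conv in \<open>auto simp: continuous_on_eq_continuous_at comp_def\<close>)
    then show ?thesis
      by (simp add: \<nu>_def integral_distr)
  qed
  have [measurable]: "(\<lambda>y. min 1 (infdist y K)) \<in> borel_measurable borel"
    by (intro borel_measurable_continuous_onI continuous_intros)
  \<comment> \<open>The distance to \<open>K\<close> vanishes at every code, hence integrates to 0 in the limit;
    truncation at 1 makes it an admissible test function.\<close>
  have "(\<integral>y. min 1 (infdist y K) \<partial>N) = 0"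
  proof (rule LIMSEQ_unique)
    show "(\<lambda>n. \<integral>x. min 1 (infdist (s x) K) \<partial>\<mu> (r n)) \<longlonglongrightarrow> (\<integral>y. min 1 (infdist y K) \<partial>N)"
      by (rule lim[of _ 1]) (auto intro!: continuous_intros simp: infdist_nonneg)
    have "infdist (s x) K = 0" for x
      using K(2) by (intro infdist_zero) auto
    then show "(\<lambda>n. \<integral>x. min 1 (infdist (s x) K) \<partial>\<mu> (r n)) \<longlonglongrightarrow> 0"
      by simp
  qed
  moreover have "integrable N (\<lambda>y. min 1 (infdist y K))"
    by (rule N.integrable_const_bound[where B = 1]) (auto simp: infdist_nonneg)
  ultimately have "AE y in N. min 1 (infdist y K) = 0"
    by (subst (asm) integral_nonneg_eq_0_iff_AE) (auto simp: infdist_nonneg)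
  then have AE_K: "AE y in N. y \<in> K"
  proof (rule AE_mp[OF _ AE_I2], intro impI)
    fix y assume "min 1 (infdist y K) = 0"
    then have "infdist y K = 0" by (auto simp: min_def split: if_splits)
    then show "y \<in> K"
      using in_closed_iff_infdist_zero[OF K(1)] K(2) by blast
  qed
  define \<pi>' where "\<pi>' y = (if y \<in> K then \<pi> y else undefined)" for y
  have [measurable]: "\<pi>' \<in> borel \<rightarrow>\<^sub>M borel"
  proof -
    have "K \<in> sets borel" using K(1) by simp
    moreover have "\<pi> \<in> restrict_space borel K \<rightarrow>\<^sub>M borel"
      by (rule borel_measurable_continuous_on_restrict[OF K(3)])
    ultimately show ?thesis
      unfolding \<pi>'_def by (subst measurable_If_restrict_space_iff) auto
  qed
  define M where "M = distr N borel \<pi>'"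
  show ?thesis
  proof
    show "strict_mono r" by (rule r)
    show "prob_space M" unfolding M_def by (rule N.prob_space_distr) simp
    show "sets M = sets borel" by (simp add: M_def)
    fix f :: "'a \<Rightarrow>\<^sub>C real"
    have bound: "norm (f x) \<le> norm f" for x by (rule norm_bounded)
    have "continuous_on K (\<lambda>y. f (\<pi> y))"
      by (rule continuous_on_compose2[OF _ K(3), of UNIV]) auto
    then obtain h where h: "continuous_on UNIV h" "\<And>y. y \<in> K \<Longrightarrow> h y = f (\<pi> y)"
      "\<And>y. y \<in> UNIV \<Longrightarrow> norm (h y) \<le> norm f"
      by (rule Tietze[of K _ UNIV "norm f"]) (use K bound in auto)
    have [measurable]: "h \<in> borel_measurable borel" "apply_bcontfun f \<in> borel_measurable borel"
      by (intro borel_measurable_continuous_onI h continuous_on_apply_bcontfun)+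
    have "(\<lambda>n. \<integral>x. h (s x) \<partial>\<mu> (r n)) \<longlonglongrightarrow> (\<integral>y. h y \<partial>N)"
      by (rule lim[of _ "norm f"]) (use h in auto)
    moreover have hf: "AE y in N. h y = f (\<pi>' y)"
      using AE_K by eventually_elim (simp add: h(2) \<pi>'_def)
    moreover have "h (s x) = f x" for x
      using h(2)[of "s x"] K(2) \<pi>(2) by auto
    moreover have "(\<integral>y. h y \<partial>N) = (\<integral>x. f x \<partial>M)"
      unfolding M_def
      by (subst integral_distr) (auto intro!: integral_cong_AE simp: hf)
    ultimately show "(\<lambda>n. \<integral>x. f x \<partial>\<mu> (r n)) \<longlonglongrightarrow> (\<integral>x. f x \<partial>M)" by simp
  qed
qed

section \<open>Invariant and maximising measures\<close>

lemma integrable_bcontfun: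
  fixes f :: "'a::metric_space \<Rightarrow>\<^sub>C real"
  assumes "prob_space \<mu>" and "sets \<mu> = sets borel"
  shows "integrable \<mu> (apply_bcontfun f)"
proof -
  interpret prob_space \<mu> by fact
  have [measurable_cong]: "sets \<mu> = sets borel" by fact
  have [measurable]: "apply_bcontfun f \<in> borel_measurable borel"
    by (intro borel_measurable_continuous_onI continuous_on_apply_bcontfun)
  show ?thesis
    by (rule integrable_const_bound[where B = "norm f"]) (use norm_bounded[of f] in auto)
qed

lemma invariant_measuresI:
  assumes "continuous_on UNIV T" and "prob_space \<mu>" and s: "sets \<mu> = sets borel"
    and "distr \<mu> borel T = \<mu>"
  shows "\<mu> \<in> invariant_measures T"
proof -
  have [measurable_cong]: "sets \<mu> = sets borel" by fact
  have [measurable]: "T \<in> borel \<rightarrow>\<^sub>M borel"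
    by (intro borel_measurable_continuous_onI assms)
  have "emeasure \<mu> (T -` A) = emeasure \<mu> A" if "A \<in> sets borel" for A
  proof -
    have "emeasure \<mu> A = emeasure (distr \<mu> borel T) A"
      by (simp add: assms(4))
    also have "\<dots> = emeasure \<mu> (T -` A)"
      using that sets_eq_imp_space_eq[OF s] by (subst emeasure_distr) auto
    finally show ?thesis by simp
  qed
  then show ?thesis
    using assms by (simp add: invariant_measures_def)
qed

lemma invariant_measuresD:
  assumes "\<mu> \<in> invariant_measures T"
  shows "prob_space \<mu>" and "sets \<mu> = sets borel"
  using assms by (auto simp: invariant_measures_def)

lemma integral_invariant_comp:
  fixes f :: "'a::metric_space \<Rightarrow>\<^sub>C real"
  assumes "continuous_on UNIV T" and \<mu>: "\<mu> \<in> invariant_measures T"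
  shows "(\<integral>x. f (T x) \<partial>\<mu>) = (\<integral>x. f x \<partial>\<mu>)"
proof -
  have s [measurable_cong]: "sets \<mu> = sets borel" by (rule invariant_measuresD[OF \<mu>])
  have [measurable]: "T \<in> borel \<rightarrow>\<^sub>M borel" "apply_bcontfun f \<in> borel_measurable borel"
    by (intro borel_measurable_continuous_onI assms continuous_on_apply_bcontfun)+
  have "distr \<mu> borel T = \<mu>"
  proof (rule measure_eqI)
    fix A assume "A \<in> sets (distr \<mu> borel T)"
    then show "emeasure (distr \<mu> borel T) A = emeasure \<mu> A"
      using \<mu> sets_eq_imp_space_eq[OF s]
      by (subst emeasure_distr) (auto simp: invariant_measures_def)
  qed (simp add: s)
  then show ?thesis
    using integral_distr[of T \<mu> borel "apply_bcontfun f"] by simp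
qed

text \<open>
The common core of two existence proofs: it yields an invariant measure from orbit averages, and a
maximising measure from invariant measures with nearly maximal integrals.
\<close>

lemma asymptotically_invariant_limit:
  fixes T :: "'a::metric_space \<Rightarrow> 'a"
  assumes compact: "compact (UNIV :: 'a set)" and T: "continuous_on UNIV T"
    and \<mu>: "\<And>n. prob_space (\<mu> n)" "\<And>n. sets (\<mu> n) = sets borel"
    and inv: "\<And>f :: 'a \<Rightarrow>\<^sub>C real. (\<lambda>n. (\<integral>x. f (T x) \<partial>\<mu> n) - (\<integral>x. f x \<partial>\<mu> n)) \<longlonglongrightarrow> 0"
  shows "\<exists>r M. strict_mono r \<and> M \<in> invariant_measures T
    \<and> (\<forall>f :: 'a \<Rightarrow>\<^sub>C real. (\<lambda>n. \<integral>x. f x \<partial>\<mu> (r n)) \<longlonglongrightarrow> (\<integral>x. f x \<partial>M))"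
proof -
  obtain r M where r: "strict_mono r" and M: "prob_space M" "sets M = sets borel"
    and lim: "\<And>f :: 'a \<Rightarrow>\<^sub>C real. (\<lambda>n. \<integral>x. f x \<partial>\<mu> (r n)) \<longlonglongrightarrow> (\<integral>x. f x \<partial>M)"
    by (rule prob_measures_seq_compact[of \<mu>, OF compact \<mu>], rule that, blast+)
  obtain \<phi> :: "nat \<Rightarrow> 'a \<Rightarrow>\<^sub>C real"
    where \<phi>: "\<And>\<mu> \<nu>. prob_space \<mu> \<Longrightarrow> sets \<mu> = sets borel \<Longrightarrow> prob_space \<nu> \<Longrightarrow> sets \<nu> = sets borel
      \<Longrightarrow> \<forall>n. (\<integral>x. \<phi> n x \<partial>\<mu>) = (\<integral>x. \<phi> n x \<partial>\<nu>) \<Longrightarrow> \<mu> = \<nu>"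
    using countable_determining_functions[OF compact] by blast
  have [measurable_cong]: "sets M = sets borel" by fact
  have [measurable]: "T \<in> borel \<rightarrow>\<^sub>M borel"
    by (intro borel_measurable_continuous_onI T)
  have "distr M borel T = M"
  proof (rule \<phi>; (intro allI)?)
    show "prob_space (distr M borel T)"
      by (rule prob_space.prob_space_distr[OF M(1)]) measurable
    fix n
    define f where "f = \<phi> n"
    have [measurable]: "apply_bcontfun f \<in> borel_measurable borel"
      by (intro borel_measurable_continuous_onI continuous_on_apply_bcontfun)
    define g where "g = Bcontfun (\<lambda>x. f (T x))"
    have g: "apply_bcontfun g = (\<lambda>x. f (T x))"
      unfolding g_def
      by (intro Bcontfun_inverse bcontfun_normI[where b = "norm f"] norm_bounded
           continuous_on_compose2[OF continuous_on_apply_bcontfun T]) auto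
    have "(\<lambda>n. (\<integral>x. g x \<partial>\<mu> (r n)) - (\<integral>x. f x \<partial>\<mu> (r n))) \<longlonglongrightarrow> (\<integral>x. g x \<partial>M) - (\<integral>x. f x \<partial>M)"
      by (intro tendsto_diff lim)
    moreover have "(\<lambda>n. (\<integral>x. g x \<partial>\<mu> (r n)) - (\<integral>x. f x \<partial>\<mu> (r n))) \<longlonglongrightarrow> 0"
      using LIMSEQ_subseq_LIMSEQ[OF inv[of f] r] by (simp add: comp_def g)
    ultimately have "(\<integral>x. g x \<partial>M) = (\<integral>x. f x \<partial>M)"
      using LIMSEQ_unique by fastforce
    then show "(\<integral>x. \<phi> n x \<partial>distr M borel T) = (\<integral>x. \<phi> n x \<partial>M)"
      by (simp add: integral_distr g flip: f_def)
  qed (simp_all add: M)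
  then have "M \<in> invariant_measures T"
    by (intro invariant_measuresI T M)
  with r lim show ?thesis by blast
qed

text \<open>
The Krylov--Bogolyubov argument: the uniform measure on an orbit segment of length \<open>n + 1\<close> changes by
\<open>O(1/n)\<close> under \<open>T\<close>, by telescoping.
\<close>

lemma invariant_measures_nonempty:
  fixes T :: "'a::metric_space \<Rightarrow> 'a"
  assumes compact: "compact (UNIV :: 'a set)" and T: "continuous_on UNIV T"
  shows "invariant_measures T \<noteq> {}"
proof -
  define x\<^sub>0 :: 'a where "x\<^sub>0 = undefined"
  define \<mu> :: "nat \<Rightarrow> 'a measure"
    where "\<mu> n = distr (measure_pmf (pmf_of_set {..n})) borel (\<lambda>k. (T ^^ k) x\<^sub>0)" for n
  have \<mu>: "prob_space (\<mu> n)" "sets (\<mu> n) = sets borel" for n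
    unfolding \<mu>_def by (auto intro!: measure_pmf.prob_space_distr)
  have [measurable]: "T \<in> borel \<rightarrow>\<^sub>M borel"
    by (intro borel_measurable_continuous_onI T)
  have "(\<lambda>n. (\<integral>x. f (T x) \<partial>\<mu> n) - (\<integral>x. f x \<partial>\<mu> n)) \<longlonglongrightarrow> 0" for f :: "'a \<Rightarrow>\<^sub>C real"
  proof -
    have [measurable]: "apply_bcontfun f \<in> borel_measurable borel"
      by (intro borel_measurable_continuous_onI continuous_on_apply_bcontfun)
    have avg: "(\<integral>x. h x \<partial>\<mu> n) = (\<Sum>k\<le>n. h ((T ^^ k) x\<^sub>0)) / Suc n"
      if [measurable]: "h \<in> borel_measurable borel" for h :: "'a \<Rightarrow> real" and n
      by (simp add: \<mu>_def integral_distr integral_pmf_of_set)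
    have eq: "(\<integral>x. f (T x) \<partial>\<mu> n) - (\<integral>x. f x \<partial>\<mu> n) = (f ((T ^^ Suc n) x\<^sub>0) - f x\<^sub>0) / Suc n" for n
    proof -
      have "(\<integral>x. f (T x) \<partial>\<mu> n) - (\<integral>x. f x \<partial>\<mu> n)
        = (\<Sum>k\<le>n. f ((T ^^ Suc k) x\<^sub>0) - f ((T ^^ k) x\<^sub>0)) / Suc n"
        by (subst (1 2) avg) (simp_all add: sum_subtractf diff_divide_distrib)
      also have "(\<Sum>k\<le>n. f ((T ^^ Suc k) x\<^sub>0) - f ((T ^^ k) x\<^sub>0)) = f ((T ^^ Suc n) x\<^sub>0) - f x\<^sub>0"
        using sum_lessThan_telescope[of "\<lambda>k. f ((T ^^ k) x\<^sub>0)" "Suc n"]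
        by (simp only: lessThan_Suc_atMost) simp
      finally show ?thesis .
    qed
    have bound: "norm ((f ((T ^^ Suc n) x\<^sub>0) - f x\<^sub>0) / Suc n) \<le> 2 * norm f / Suc n" for n
      using norm_bounded[of f "(T ^^ Suc n) x\<^sub>0"] norm_bounded[of f x\<^sub>0]
      by (auto simp: divide_simps)
    have null: "(\<lambda>n. 2 * norm f / Suc n) \<longlonglongrightarrow> 0"
      by (rule LIMSEQ_Suc[OF lim_const_over_n[of "2 * norm f"]])
    show ?thesis
      unfolding eq by (rule Lim_null_comparison[OF always_eventually null]) (intro allI bound)
  qed
  from asymptotically_invariant_limit[of T \<mu>, OF compact T \<mu> this] show ?thesis
    by blast
qed

lemma integral_le_max_ergodic_average:
  assumes "\<mu> \<in> invariant_measures T"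
  shows "(\<integral>x. apply_bcontfun f x \<partial>\<mu>) \<le> max_ergodic_average T f"
proof -
  have "(\<integral>x. apply_bcontfun f x \<partial>\<nu>) \<le> norm f" if "\<nu> \<in> invariant_measures T" for \<nu>
  proof -
    interpret prob_space \<nu> by (rule invariant_measuresD[OF that])
    have "(\<integral>x. apply_bcontfun f x \<partial>\<nu>) \<le> (\<integral>x. norm f \<partial>\<nu>)"
      using norm_bounded[of f] invariant_measuresD[OF that]
      by (intro integral_mono integrable_bcontfun) (auto simp: abs_le_iff)
    then show ?thesis by (simp add: prob_space)
  qed
  then show ?thesis
    unfolding max_ergodic_average_def by (intro cSUP_upper assms bdd_aboveI2[where M = "norm f"])
qed

lemma maximising_measures_nonempty:
  fixes T :: "'a::metric_space \<Rightarrow> 'a"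
  assumes compact: "compact (UNIV :: 'a set)" and T: "continuous_on UNIV T"
  shows "maximising_measures T f \<noteq> {}"
proof -
  let ?\<beta> = "max_ergodic_average T f"
  have "\<exists>\<mu>\<in>invariant_measures T. ?\<beta> - 1 / real (Suc n) < (\<integral>x. f x \<partial>\<mu>)" for n
    using less_cSUP_iff[OF invariant_measures_nonempty[OF compact T] bdd_aboveI2,
        of "\<lambda>\<mu>. \<integral>x. f x \<partial>\<mu>" ?\<beta> "?\<beta> - 1 / real (Suc n)"]
      integral_le_max_ergodic_average[of _ T f]
    by (simp add: max_ergodic_average_def)
  then obtain \<mu> where \<mu>: "\<And>n. \<mu> n \<in> invariant_measures T"
    and near: "\<And>n. ?\<beta> - 1 / real (Suc n) < (\<integral>x. f x \<partial>\<mu> n)"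
    by metis
  have "(\<lambda>n. (\<integral>x. f (T x) \<partial>\<mu> n) - (\<integral>x. f x \<partial>\<mu> n)) \<longlonglongrightarrow> 0" for f :: "'a \<Rightarrow>\<^sub>C real"
    using \<mu> by (simp add: integral_invariant_comp[OF T])
  from asymptotically_invariant_limit[of T \<mu>, OF compact T invariant_measuresD[OF \<mu>] this]
  obtain r M where r: "strict_mono r" and M: "M \<in> invariant_measures T"
    and lim: "\<And>f :: 'a \<Rightarrow>\<^sub>C real. (\<lambda>n. \<integral>x. f x \<partial>\<mu> (r n)) \<longlonglongrightarrow> (\<integral>x. f x \<partial>M)"
    by blast
  have "(\<lambda>n. \<integral>x. f x \<partial>\<mu> n) \<longlonglongrightarrow> ?\<beta>"
  proof (rule tendsto_sandwich)
    show "(\<lambda>n. ?\<beta> - 1 / real (Suc n)) \<longlonglongrightarrow> ?\<beta>"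
      using tendsto_diff[OF tendsto_const LIMSEQ_Suc[OF lim_const_over_n[of 1]], of ?\<beta>] by simp
    show "(\<lambda>_. ?\<beta>) \<longlonglongrightarrow> ?\<beta>" by simp
  qed (intro always_eventually allI less_imp_le near integral_le_max_ergodic_average \<mu>)+
  from LIMSEQ_subseq_LIMSEQ[OF this r] have "(\<lambda>n. \<integral>x. f x \<partial>\<mu> (r n)) \<longlonglongrightarrow> ?\<beta>"
    by (simp add: comp_def)
  then have "(\<integral>x. f x \<partial>M) = ?\<beta>"
    by (rule LIMSEQ_unique[OF lim])
  then show ?thesis
    using M by (auto simp: maximising_measures_def)
qed

lemma abs_integral_bcontfun_diff_le:
  fixes f g :: "'a::metric_space \<Rightarrow>\<^sub>C real"
  assumes "prob_space \<mu>" and "sets \<mu> = sets borel"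
  shows "\<bar>(\<integral>x. f x \<partial>\<mu>) - (\<integral>x. g x \<partial>\<mu>)\<bar> \<le> dist f g"
proof -
  interpret prob_space \<mu> by fact
  note int = integrable_bcontfun[OF assms]
  have "\<bar>(\<integral>x. f x \<partial>\<mu>) - (\<integral>x. g x \<partial>\<mu>)\<bar> = \<bar>\<integral>x. f x - g x \<partial>\<mu>\<bar>"
    by (simp add: int)
  also have "\<dots> \<le> (\<integral>x. \<bar>f x - g x\<bar> \<partial>\<mu>)"
    by (rule integral_abs_bound)
  also have "\<dots> \<le> (\<integral>x. dist f g \<partial>\<mu>)"
    using dist_bounded[of f _ g] by (intro integral_mono) (auto simp: int dist_real_def)
  finally show ?thesis by (simp add: prob_space)
qed

lemma max_ergodic_average_lipschitz:
  fixes T :: "'a::metric_space \<Rightarrow> 'a"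
  assumes "compact (UNIV :: 'a set)" and "continuous_on UNIV T"
  shows "\<bar>max_ergodic_average T f - max_ergodic_average T g\<bar> \<le> dist f g"
proof -
  have "max_ergodic_average T f \<le> max_ergodic_average T g + dist f g" for f g
  proof -
    obtain \<mu> where "\<mu> \<in> maximising_measures T f"
      using maximising_measures_nonempty[OF assms, of f] by blast
    then have \<mu>: "\<mu> \<in> invariant_measures T" "(\<integral>x. f x \<partial>\<mu>) = max_ergodic_average T f"
      by (auto simp: maximising_measures_def)
    have "(\<integral>x. f x \<partial>\<mu>) \<le> (\<integral>x. g x \<partial>\<mu>) + dist f g"
      using abs_integral_bcontfun_diff_le[OF invariant_measuresD[OF \<mu>(1)], of f g] by simp
    then show ?thesis
      using integral_le_max_ergodic_average[OF \<mu>(1), of g] \<mu>(2) by simp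
  qed
  from this[of f g] this[of g f] show ?thesis by (simp add: dist_commute abs_le_iff)
qed

lemma continuous_max_ergodic_average:
  fixes T :: "'a::metric_space \<Rightarrow> 'a"
  assumes "compact (UNIV :: 'a set)" and "continuous_on UNIV T"
  shows "continuous_on UNIV (max_ergodic_average T)"
  unfolding continuous_on_iff dist_real_def
proof (intro ballI allI impI)
  fix f :: "'a \<Rightarrow>\<^sub>C real" and e :: real assume "0 < e"
  then show "\<exists>d>0. \<forall>g\<in>UNIV. dist g f < d \<longrightarrow> \<bar>max_ergodic_average T g - max_ergodic_average T f\<bar> < e"
    by (intro exI[of _ e] conjI ballI impI
        le_less_trans[OF max_ergodic_average_lipschitz[OF assms]])
qed

section \<open>Directional derivatives of the maximum ergodic average\<close>

text \<open>
For a convex function, failure of differentiability at \<open>h\<close> along \<open>g\<close> means that the symmetric second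
difference with step \<open>s\<close> stays above a fixed positive multiple of \<open>s\<close> as \<open>s\<close> tends to 0. Testing only
the steps \<open>1/(k+1)\<close> and the constants \<open>1/(j+1)\<close> exhibits the set as a countable union of closed sets,
so its measurability is immediate.
\<close>

definition nondifferentiable_along :: "('a::metric_space \<Rightarrow> 'a) \<Rightarrow> ('a \<Rightarrow>\<^sub>C real) \<Rightarrow> ('a \<Rightarrow>\<^sub>C real) set"
  where "nondifferentiable_along T g =
    (\<Union>j::nat. \<Inter>k::nat. {h. 1 / (real (Suc j) * real (Suc k))
      \<le> max_ergodic_average T (h + (1 / real (Suc k)) *\<^sub>R g)
        + max_ergodic_average T (h - (1 / real (Suc k)) *\<^sub>R g) - 2 * max_ergodic_average T h})"

lemma sets_nondifferentiable_along:
  fixes T :: "'a::metric_space \<Rightarrow> 'a"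
  assumes "compact (UNIV :: 'a set)" and "continuous_on UNIV T"
  shows "nondifferentiable_along T g \<in> sets borel"
proof -
  note \<beta> = continuous_on_compose2[OF continuous_max_ergodic_average[OF assms], of UNIV]
  have "closed {h. 1 / (real (Suc j) * real (Suc k))
      \<le> max_ergodic_average T (h + (1 / real (Suc k)) *\<^sub>R g)
        + max_ergodic_average T (h - (1 / real (Suc k)) *\<^sub>R g) - 2 * max_ergodic_average T h}" for j k
    by (intro closed_Collect_le continuous_intros \<beta>) (rule subset_UNIV)+
  then have "closed (\<Inter>k. {h. 1 / (real (Suc j) * real (Suc k))
      \<le> max_ergodic_average T (h + (1 / real (Suc k)) *\<^sub>R g)
        + max_ergodic_average T (h - (1 / real (Suc k)) *\<^sub>R g) - 2 * max_ergodic_average T h})" for j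
    by (intro closed_INT ballI)
  then show ?thesis
    unfolding nondifferentiable_along_def by (intro sets.countable_nat_UN image_subsetI borel_closed)
qed

lemma integral_add_scaleR:
  fixes f g :: "'a::metric_space \<Rightarrow>\<^sub>C real"
  assumes "\<mu> \<in> invariant_measures T"
  shows "(\<integral>x. (f + c *\<^sub>R g) x \<partial>\<mu>) = (\<integral>x. f x \<partial>\<mu>) + c * (\<integral>x. g x \<partial>\<mu>)"
  using integrable_bcontfun[OF invariant_measuresD[OF assms]] by simp

text \<open>
If \<open>\<integral>g d\<mu> - \<integral>g d\<nu> > 1/(j+1)\<close>, use \<open>\<mu>\<close> as a competitor at \<open>h + s g\<close> and \<open>\<nu>\<close> at \<open>h - s g\<close>. Together they
force the second difference of the maximum ergodic average to be at least \<open>s/(j+1)\<close>.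
\<close>

lemma maximising_integral_unique:
  fixes T :: "'a::metric_space \<Rightarrow> 'a"
  assumes \<mu>: "\<mu> \<in> maximising_measures T h" and \<nu>: "\<nu> \<in> maximising_measures T h"
    and nd: "h \<notin> nondifferentiable_along T g"
  shows "(\<integral>x. g x \<partial>\<mu>) = (\<integral>x. g x \<partial>\<nu>)"
proof -
  have "(\<integral>x. g x \<partial>\<mu>) \<le> (\<integral>x. g x \<partial>\<nu>)"
    if \<mu>: "\<mu> \<in> maximising_measures T h" and \<nu>: "\<nu> \<in> maximising_measures T h" for \<mu> \<nu>
  proof (rule ccontr)
    assume "\<not> ?thesis"
    then obtain j where j: "1 / real (Suc j) < (\<integral>x. g x \<partial>\<mu>) - (\<integral>x. g x \<partial>\<nu>)"
      using nat_approx_posE[of "(\<integral>x. g x \<partial>\<mu>) - (\<integral>x. g x \<partial>\<nu>)"] by auto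
    have "1 / (real (Suc j) * real (Suc k))
      \<le> max_ergodic_average T (h + (1 / real (Suc k)) *\<^sub>R g)
        + max_ergodic_average T (h - (1 / real (Suc k)) *\<^sub>R g) - 2 * max_ergodic_average T h" for k
    proof -
      define c where "c = 1 / real (Suc k)"
      have "1 / (real (Suc j) * real (Suc k)) = c * (1 / real (Suc j))"
        by (simp add: c_def)
      also have "\<dots> \<le> c * ((\<integral>x. g x \<partial>\<mu>) - (\<integral>x. g x \<partial>\<nu>))"
        using j by (intro mult_left_mono) (auto simp: c_def)
      moreover have "max_ergodic_average T h + c * (\<integral>x. g x \<partial>\<mu>) \<le> max_ergodic_average T (h + c *\<^sub>R g)"
        using \<mu> integral_le_max_ergodic_average[of \<mu> T "h + c *\<^sub>R g"]
          integral_add_scaleR[of \<mu> T h c g]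
        by (auto simp: maximising_measures_def)
      moreover have "max_ergodic_average T h + (- c) * (\<integral>x. g x \<partial>\<nu>) \<le> max_ergodic_average T (h - c *\<^sub>R g)"
        using \<nu> integral_le_max_ergodic_average[of \<nu> T "h + (- c) *\<^sub>R g"]
          integral_add_scaleR[of \<nu> T h "- c" g]
        by (auto simp: maximising_measures_def)
      ultimately show ?thesis
        unfolding c_def[symmetric] right_diff_distrib by linarith
    qed
    then show False
      using nd by (auto simp: nondifferentiable_along_def)
  qed
  from this[OF \<mu> \<nu>] this[OF \<nu> \<mu>] show ?thesis by (rule antisym)
qed

text \<open>
Along the line, the integral \<open>p s\<close> of \<open>g\<close> against a chosen maximising measure of \<open>h + s g\<close> is a
subgradient of the convex function \<open>s \<mapsto> \<beta> (h + s g)\<close>, so \<open>p\<close> is monotone and has at most countably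
many discontinuities. A point of nondifferentiability is a discontinuity of \<open>p\<close>, since the second
difference is bounded by the step times the oscillation of \<open>p\<close>.
\<close>

lemma countable_nondifferentiable_on_line:
  fixes T :: "'a::metric_space \<Rightarrow> 'a"
  assumes compact: "compact (UNIV :: 'a set)" and T: "continuous_on UNIV T"
  shows "countable {s. h + s *\<^sub>R g \<in> nondifferentiable_along T g}"
proof -
  let ?\<beta> = "\<lambda>s. max_ergodic_average T (h + s *\<^sub>R g)"
  define \<mu> where "\<mu> s = (SOME \<mu>. \<mu> \<in> maximising_measures T (h + s *\<^sub>R g))" for s
  have "\<mu> s \<in> maximising_measures T (h + s *\<^sub>R g)" for s
    unfolding \<mu>_def by (rule someI_ex) (use maximising_measures_nonempty[OF compact T] in blast)
  then have inv: "\<mu> s \<in> invariant_measures T" and max: "(\<integral>x. (h + s *\<^sub>R g) x \<partial>\<mu> s) = ?\<beta> s" for s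
    by (auto simp: maximising_measures_def)
  define p where "p s = (\<integral>x. g x \<partial>\<mu> s)" for s
  have subgradient: "?\<beta> s + (t - s) * p s \<le> ?\<beta> t" for s t
    using integral_le_max_ergodic_average[OF inv, of s "h + t *\<^sub>R g"] max[of s]
      integral_add_scaleR[OF inv[of s], of h t g] integral_add_scaleR[OF inv[of s], of h s g]
    by (simp add: p_def left_diff_distrib)
  have "mono p"
  proof (rule monoI)
    fix s t :: real assume "s \<le> t"
    have "(t - s) * p s \<le> (t - s) * p t"
      using subgradient[of s t] subgradient[of t s] by (simp add: left_diff_distrib)
    then show "p s \<le> p t"
      using \<open>s \<le> t\<close> by (cases "s = t") auto
  qed
  have "\<not> isCont p s" if nd: "h + s *\<^sub>R g \<in> nondifferentiable_along T g" for s
  proof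
    assume "isCont p s"
    obtain j where j: "\<And>k. 1 / (real (Suc j) * real (Suc k))
        \<le> ?\<beta> (s + 1 / real (Suc k)) + ?\<beta> (s - 1 / real (Suc k)) - 2 * ?\<beta> s"
      using nd by (auto simp: nondifferentiable_along_def scaleR_left_distrib scaleR_left_diff_distrib
          algebra_simps)
    have "1 / real (Suc j) \<le> p (s + 1 / real (Suc k)) - p (s - 1 / real (Suc k))" for k
    proof -
      let ?c = "1 / real (Suc k)"
      have "?c * (1 / real (Suc j)) \<le> ?c * (p (s + ?c) - p (s - ?c))"
        using j[of k] subgradient[of "s + ?c" s] subgradient[of "s - ?c" s]
        by (simp add: right_diff_distrib mult.commute)
      then show ?thesis by (rule mult_left_le_imp_le) simp
    qed
    moreover have "(\<lambda>k. p (s + 1 / real (Suc k)) - p (s - 1 / real (Suc k))) \<longlonglongrightarrow> p s - p s"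
    proof (intro tendsto_diff isCont_tendsto_compose[OF \<open>isCont p s\<close>])
      have "(\<lambda>k. 1 / real (Suc k)) \<longlonglongrightarrow> 0"
        by (rule LIMSEQ_Suc[OF lim_const_over_n])
      then show "(\<lambda>k. s + 1 / real (Suc k)) \<longlonglongrightarrow> s" "(\<lambda>k. s - 1 / real (Suc k)) \<longlonglongrightarrow> s"
        using tendsto_add[OF tendsto_const, of _ 0 sequentially s]
          tendsto_diff[OF tendsto_const, of _ 0 sequentially s] by auto
    qed
    ultimately have "1 / real (Suc j) \<le> p s - p s"
      by (intro LIMSEQ_le_const) auto
    then show False by simp
  qed
  then show ?thesis
    by (intro countable_subset[OF _ mono_ctble_discont[OF \<open>mono p\<close>]]) auto
qed

section \<open>Joint continuity of sums in a metrised vector space\<close>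

lemma (in Metric_space) continuous_map_euclidean_mtopology_iff:
  fixes f :: "'p::metric_space \<Rightarrow> 'a"
  shows "continuous_map euclidean mtopology f \<longleftrightarrow>
    (\<forall>x. f x \<in> M) \<and> (\<forall>x. \<forall>e>0. \<exists>\<delta>>0. \<forall>y. dist y x < \<delta> \<longrightarrow> d (f x) (f y) < e)" (is "?lhs \<longleftrightarrow> ?rhs")
proof
  assume L: ?lhs
  then have M: "f x \<in> M" for x
    by (auto simp: continuous_map_def)
  have "\<exists>\<delta>>0. \<forall>y. dist y x < \<delta> \<longrightarrow> d (f x) (f y) < e" if e: "0 < e" for x e
  proof -
    obtain U where U: "open U" "x \<in> U" "\<forall>y\<in>U. f y \<in> mball (f x) e"
      using L e unfolding continuous_map_to_metric by (metis UNIV_I open_openin topspace_euclidean)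
    then obtain \<delta> where "0 < \<delta>" "\<forall>y. dist y x < \<delta> \<longrightarrow> y \<in> U"
      by (auto simp: open_dist)
    with U(3) show ?thesis
      by (intro exI[of _ \<delta>]) auto
  qed
  with M show ?rhs by blast
next
  assume R: ?rhs
  show ?lhs
    unfolding continuous_map_to_metric
  proof (intro ballI allI impI)
    fix x and e :: real assume "0 < e"
    then obtain \<delta> where "0 < \<delta>" "\<forall>y. dist y x < \<delta> \<longrightarrow> d (f x) (f y) < e"
      using R by blast
    with R show "\<exists>U. openin euclidean U \<and> x \<in> U \<and> (\<forall>y\<in>U. f y \<in> mball (f x) e)"
      by (intro exI[of _ "ball x \<delta>"]) (auto simp: dist_commute)
  qed
qed

text \<open>
For fixed \<open>k\<close> the closed sets \<open>C N k\<close> of those \<open>s\<close> for which \<open>F p s\<close> stays within \<open>1/(k+1)\<close> of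
\<open>F p\<^sub>0 s\<close> when \<open>p\<close> is in the ball of radius \<open>1/(N+1)\<close> around \<open>p\<^sub>0\<close> cover the line. Their frontiers are nowhere dense, so
Baire's theorem gives a point \<open>s\<^sub>0\<close> outside all of them. For every \<open>k\<close> it then lies in the interior of
some \<open>C N k\<close>, which is joint continuity at \<open>(p\<^sub>0, s\<^sub>0)\<close>.
\<close>

lemma (in Metric_space) separately_continuous_jointly_continuous_point:
  fixes F :: "'p::metric_space \<Rightarrow> real \<Rightarrow> 'a"
  assumes cont_p: "\<And>s. continuous_map euclidean mtopology (\<lambda>p. F p s)"
    and cont_s: "\<And>p. continuous_map euclideanreal mtopology (F p)"
  shows "\<exists>s\<^sub>0. \<forall>e>0. \<exists>\<delta>>0. \<forall>p s. dist p p\<^sub>0 < \<delta> \<longrightarrow> dist s s\<^sub>0 < \<delta> \<longrightarrow> d (F p\<^sub>0 s\<^sub>0) (F p s) < e"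
proof -
  have M: "F p s \<in> M" for p s
    using cont_s[of p] by (auto simp: continuous_map_def)
  define C where
    "C N k = (\<Inter>p\<in>{p. dist p p\<^sub>0 < 1 / real (Suc N)}. {s. d (F p\<^sub>0 s) (F p s) \<le> 1 / real (Suc k)})" for N k
  have closed_C: "closed (C N k)" for N k
  proof -
    have "continuous_on UNIV (\<lambda>s. d (F p\<^sub>0 s) (F p s))" for p
      using continuous_map_mdist[of euclideanreal "metric (M, d)" "F p\<^sub>0" "F p"] cont_s
      by simp
    then show ?thesis
      unfolding C_def by (intro closed_INT ballI closed_Collect_le continuous_on_const)
  qed
  have cover: "\<exists>N. s \<in> C N k" for s k
  proof -
    obtain \<delta> where \<delta>: "0 < \<delta>" "\<And>p. dist p p\<^sub>0 < \<delta> \<Longrightarrow> d (F p\<^sub>0 s) (F p s) < 1 / real (Suc k)"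
      using cont_p[of s] unfolding continuous_map_euclidean_mtopology_iff
      by (metis of_nat_0_less_iff zero_less_Suc zero_less_divide_1_iff)
    obtain N where N: "1 / real (Suc N) < \<delta>"
      using nat_approx_posE[OF \<delta>(1)] by blast
    have "d (F p\<^sub>0 s) (F p s) \<le> 1 / real (Suc k)" if "dist p p\<^sub>0 < 1 / real (Suc N)" for p
      using \<delta>(2)[of p] that N by linarith
    then have "s \<in> C N k"
      unfolding C_def by blast
    then show ?thesis by blast
  qed
  have nowhere_dense: "interior (frontier (C N k)) = {}" for N k
  proof -
    have "interior (frontier (C N k)) \<subseteq> interior (C N k)"
      using frontier_subset_closed[OF closed_C] by (rule interior_mono)
    moreover have "interior (frontier (C N k)) \<subseteq> frontier (C N k)"
      by (rule interior_subset)
    ultimately show ?thesis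
      by (auto simp: frontier_def)
  qed
  have "euclideanreal interior_of \<Union>(range (\<lambda>(N, k). frontier (C N k))) = {}"
    by (rule Baire_category_alt) (auto simp: completely_metrizable_space_euclidean nowhere_dense)
  then have "\<Union>(range (\<lambda>(N, k). frontier (C N k))) \<noteq> UNIV"
    by auto
  then obtain s\<^sub>0 where s\<^sub>0: "\<And>N k. s\<^sub>0 \<notin> frontier (C N k)"
    by auto
  have "\<exists>\<delta>>0. \<forall>p s. dist p p\<^sub>0 < \<delta> \<longrightarrow> dist s s\<^sub>0 < \<delta> \<longrightarrow> d (F p\<^sub>0 s\<^sub>0) (F p s) < e" if e: "0 < e" for e
  proof -
    obtain k where k: "1 / real (Suc k) < e / 2"
      using nat_approx_posE[of "e / 2"] e by auto
    obtain N where "s\<^sub>0 \<in> C N k"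
      using cover by blast
    then have "s\<^sub>0 \<in> interior (C N k)"
      using s\<^sub>0[of N k] closure_subset[of "C N k"] by (auto simp: frontier_def)
    then obtain \<eta> where \<eta>: "0 < \<eta>" "\<And>s. dist s s\<^sub>0 < \<eta> \<Longrightarrow> s \<in> C N k"
      using open_interior[of "C N k"] interior_subset[of "C N k"] unfolding open_dist by blast
    obtain \<zeta> where \<zeta>: "0 < \<zeta>" "\<And>s. dist s s\<^sub>0 < \<zeta> \<Longrightarrow> d (F p\<^sub>0 s\<^sub>0) (F p\<^sub>0 s) < e / 2"
      using cont_s[of p\<^sub>0] e unfolding continuous_map_euclidean_mtopology_iff
      by (metis half_gt_zero)
    define \<delta> where "\<delta> = min (1 / real (Suc N)) (min \<eta> \<zeta>)"
    have "d (F p\<^sub>0 s\<^sub>0) (F p s) < e" if "dist p p\<^sub>0 < \<delta>" "dist s s\<^sub>0 < \<delta>" for p s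
    proof -
      have "s \<in> C N k" "d (F p\<^sub>0 s\<^sub>0) (F p\<^sub>0 s) < e / 2"
        using that \<eta>(2) \<zeta>(2) by (auto simp: \<delta>_def)
      moreover from this have "d (F p\<^sub>0 s) (F p s) \<le> 1 / real (Suc k)"
        using that by (auto simp: C_def \<delta>_def)
      ultimately show ?thesis
        using triangle[of "F p\<^sub>0 s\<^sub>0" "F p\<^sub>0 s" "F p s"] M k by auto
    qed
    moreover have "0 < \<delta>"
      using \<eta>(1) \<zeta>(1) by (simp add: \<delta>_def)
    ultimately show ?thesis by blast
  qed
  then show ?thesis by blast
qed

text \<open>
The topology of \<open>d\<close> may differ from any topology of the ambient space, and \<open>d\<close> need not be translation
invariant. Addition is continuous in each argument separately.
\<close>

locale metrised_subspace = Metric_space V d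
  for V :: "'b::real_vector set" and d +
  assumes subspace_V: "subspace V"
    and translation: "\<And>g. g \<in> V \<Longrightarrow> continuous_map mtopology mtopology (\<lambda>f. f + g)"
    and scaling: "continuous_map (prod_topology euclideanreal mtopology) mtopology (\<lambda>(c, f). c *\<^sub>R f)"
begin

lemma continuous_map_scaleR_left:
  assumes "g \<in> V"
  shows "continuous_map euclideanreal mtopology (\<lambda>s. s *\<^sub>R g)"
proof -
  have "continuous_map euclideanreal (prod_topology euclideanreal mtopology) (\<lambda>s. (s, g))"
    using assms by (simp add: continuous_map_paired)
  from continuous_map_compose[OF this scaling] show ?thesis
    by (simp add: comp_def)
qed

text \<open>
For fixed \<open>p\<close> there is one \<open>s\<^sub>0\<close> at which the map is jointly continuous. The translation by
\<open>(s - s\<^sub>0) *\<^sub>R g\<close> carries the behaviour near \<open>(p, s\<^sub>0)\<close> to that near \<open>(p, s)\<close>, since it commutes with the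
addition of \<open>S p\<close>.
\<close>

lemma continuous_map_add_scaleR:
  fixes S :: "'p::metric_space \<Rightarrow> 'b"
  assumes S: "continuous_map euclidean mtopology S" and g: "g \<in> V"
  shows "continuous_map euclidean mtopology (\<lambda>(p, s::real). S p + s *\<^sub>R g)"
proof -
  define F where "F p s = S p + s *\<^sub>R g" for p and s :: real
  have S_V: "S p \<in> V" for p
    using S by (auto simp: continuous_map_def)
  have F_V: "F p s \<in> V" and scale_V: "s *\<^sub>R g \<in> V" for p s
    using S_V g subspace_V by (auto simp: F_def intro!: subspace_add subspace_scale)
  have cont_p: "continuous_map euclidean mtopology (\<lambda>p. F p s)" for s
    using continuous_map_compose[OF S translation[OF scale_V[of s]]] by (simp add: comp_def F_def)
  have cont_s: "continuous_map euclideanreal mtopology (F p)" for p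
    using continuous_map_compose[OF continuous_map_scaleR_left[OF g] translation[OF S_V[of p]]]
    by (simp add: comp_def F_def[abs_def] add.commute)
  have "\<exists>\<delta>>0. \<forall>q. dist q (p, s) < \<delta> \<longrightarrow> d (F p s) (case_prod F q) < e" if e: "0 < e" for p s e
  proof -
    obtain s\<^sub>0 where s\<^sub>0: "\<And>e. 0 < e \<Longrightarrow>
        \<exists>\<delta>>0. \<forall>q t. dist q p < \<delta> \<longrightarrow> dist t s\<^sub>0 < \<delta> \<longrightarrow> d (F p s\<^sub>0) (F q t) < e"
      using separately_continuous_jointly_continuous_point[of F p, OF cont_p cont_s] by blast
    define w where "w = (s - s\<^sub>0) *\<^sub>R g"
    have shift: "F q t = F q (t - s + s\<^sub>0) + w" for q t
      by (simp add: F_def w_def algebra_simps)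
    obtain \<eta> where \<eta>: "0 < \<eta>" "\<And>v. v \<in> V \<Longrightarrow> d (F p s\<^sub>0) v < \<eta> \<Longrightarrow> d (F p s\<^sub>0 + w) (v + w) < e"
    proof -
      have w: "w \<in> V" by (simp add: w_def scale_V)
      have "openin mtopology (mball (F p s) e)" by simp
      moreover have "F p s\<^sub>0 + w = F p s" using shift[of p s] by simp
      moreover have "F p s \<in> mball (F p s) e" using F_V e by simp
      ultimately obtain r where "0 < r" "\<And>v. v \<in> V \<and> d (F p s\<^sub>0) v < r \<Longrightarrow> v + w \<in> mball (F p s) e"
        using translation[OF w] F_V[of p s\<^sub>0] unfolding continuous_map_from_metric by metis
      then show ?thesis
        using \<open>F p s\<^sub>0 + w = F p s\<close> by (intro that[of r]) auto
    qed
    obtain \<delta> where \<delta>: "0 < \<delta>" "\<And>q t. dist q p < \<delta> \<Longrightarrow> dist t s\<^sub>0 < \<delta> \<Longrightarrow> d (F p s\<^sub>0) (F q t) < \<eta>"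
      using s\<^sub>0[OF \<eta>(1)] by blast
    have "d (F p s) (F q t) < e" if "dist (q, t) (p, s) < \<delta>" for q t
    proof -
      have "dist q p < \<delta>" "dist (t - s + s\<^sub>0) s\<^sub>0 < \<delta>"
        using that dist_fst_le[of "(q, t)" "(p, s)"] dist_snd_le[of "(q, t)" "(p, s)"]
        by (auto simp: dist_real_def)
      then have "d (F p s\<^sub>0 + w) (F q (t - s + s\<^sub>0) + w) < e"
        by (intro \<eta>(2) \<delta>(2) F_V)
      then show ?thesis
        using shift[of q t] shift[of p s] by simp
    qed
    with \<delta>(1) show ?thesis
      by (intro exI[of _ \<delta>]) auto
  qed
  then show ?thesis
    unfolding continuous_map_euclidean_mtopology_iff using F_V by (auto simp: F_def)
qed

end

section \<open>A random series with compact range\<close>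

lemma compact_unit_cube: "compact {t :: nat \<Rightarrow> real. \<forall>i. t i \<in> {0..1}}"
proof -
  have "compactin (product_topology (\<lambda>_. euclideanreal) (UNIV :: nat set)) (PiE UNIV (\<lambda>_. {0..1}))"
    unfolding compactin_PiE by simp
  then show ?thesis
    by (simp add: euclidean_product_topology PiE_def Pi_def)
qed

text \<open>
The coefficients are chosen one after the other. Once the partial sum \<open>S n\<close> is continuous in \<open>t\<close>, the
joint continuity of \<open>(t, s) \<mapsto> S n t + s *\<^sub>R g n\<close> and the compactness of the cube give an \<open>a n\<close> for which
the next term moves every point by less than \<open>(1/2)^n\<close>. The sum is defined for all real sequences by
first clamping the coordinates to \<open>[0, 1]\<close>, which leaves its range unchanged.
\<close>

lemma (in metrised_subspace) uniformly_convergent_random_series: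
  fixes g :: "nat \<Rightarrow> 'b"
  assumes complete: "mcomplete" and g: "\<And>n. g n \<in> V"
  shows "\<exists>(a :: nat \<Rightarrow> real) (\<Phi> :: (nat \<Rightarrow> real) \<Rightarrow> 'b).
    (\<forall>n. 0 < a n) \<and> continuous_map euclidean mtopology \<Phi> \<and> compactin mtopology (range \<Phi>) \<and>
    (\<forall>t. (\<forall>i. t i \<in> {0..1}) \<longrightarrow>
      limitin mtopology (\<lambda>N. \<Sum>n<N. (t n * a n) *\<^sub>R g n) (\<Phi> t) sequentially)"
proof -
  define Q where "Q = {t :: nat \<Rightarrow> real. \<forall>i. t i \<in> {0..1}}"
  define P where "P n S \<longleftrightarrow> continuous_map euclidean mtopology S \<and> (n = 0 \<longrightarrow> S = (\<lambda>_. 0))"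
    for n :: nat and S :: "(nat \<Rightarrow> real) \<Rightarrow> 'b"
  define R where "R n S S' \<longleftrightarrow> (\<exists>a>0. S' = (\<lambda>t. S t + (t n * a) *\<^sub>R g n)) \<and> (\<forall>t\<in>Q. d (S t) (S' t) < (1/2) ^ n)"
    for n and S S' :: "(nat \<Rightarrow> real) \<Rightarrow> 'b"
  have "\<exists>S. \<forall>n. P n (S n) \<and> R n (S n) (S (Suc n))"
  proof (rule dependent_nat_choice)
    have "0 \<in> V" using subspace_V by (rule subspace_0)
    then show "\<exists>S. P 0 S" by (auto simp: P_def)
    fix S n assume "P n S"
    then have S: "continuous_map euclidean mtopology S" by (simp add: P_def)
    then have S_V: "S t \<in> V" for t by (auto simp: continuous_map_def)
    define D where "D q = d (S (fst q)) (S (fst q) + snd q *\<^sub>R g n)" for q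
    note add = continuous_map_add_scaleR[OF S g[of n]]
    have "continuous_map euclidean mtopology (S \<circ> fst)"
      by (rule continuous_map_compose[OF _ S]) (simp add: continuous_on_fst)
    then have "continuous_on UNIV D"
      using continuous_map_mdist[of euclidean "metric (V, d)" "S \<circ> fst" "\<lambda>(p, s). S p + s *\<^sub>R g n"] add
      by (simp add: D_def[abs_def] case_prod_beta)
    moreover have "compact (Q \<times> {0..1::real})"
      unfolding Q_def by (intro compact_Times compact_unit_cube) simp
    ultimately have "uniformly_continuous_on (Q \<times> {0..1}) D"
      by (intro compact_uniformly_continuous) (auto intro: continuous_on_subset)
    then obtain \<delta> where \<delta>: "0 < \<delta>" "\<And>q q'. q \<in> Q \<times> {0..1} \<Longrightarrow> q' \<in> Q \<times> {0..1} \<Longrightarrow> dist q' q < \<delta>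
        \<Longrightarrow> dist (D q') (D q) < (1/2) ^ n"
      unfolding uniformly_continuous_on_def by (metis half_gt_zero_iff zero_less_one zero_less_power)
    \<comment> \<open>Uniform continuity compares the parameters \<open>t n * a\<close> and 0, both in \<open>[0, 1]\<close>.\<close>
    define a where "a = min 1 (\<delta> / 2)"
    have a: "0 < a" "a \<le> 1" "a < \<delta>"
      using \<delta>(1) by (auto simp: a_def)
    define S' where "S' t = S t + (t n * a) *\<^sub>R g n" for t
    have "d (S t) (S' t) < (1/2) ^ n" if t: "t \<in> Q" for t
    proof -
      have tn: "0 \<le> t n" "t n \<le> 1" using t by (auto simp: Q_def)
      then have "0 \<le> t n * a" "t n * a \<le> 1 * a"
        using a by (auto intro!: mult_nonneg_nonneg mult_right_mono)
      then have "0 \<le> t n * a" "t n * a \<le> 1" "t n * a < \<delta>"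
        using a by linarith+
      then have *: "(t, t n * a) \<in> Q \<times> {0..1}" "(t, 0::real) \<in> Q \<times> {0..1}"
          "dist (t, t n * a) (t, 0) < \<delta>"
        using t by (auto simp: dist_prod_def)
      have "dist (D (t, t n * a)) (D (t, 0)) < (1/2) ^ n"
        by (rule \<delta>(2)) (use * in auto)
      moreover have "D (t, 0) = 0"
        using S_V by (simp add: D_def)
      ultimately show ?thesis by (simp add: D_def S'_def)
    qed
    moreover have "continuous_map euclidean mtopology S'"
    proof -
      have "continuous_map euclidean euclidean (\<lambda>t :: nat \<Rightarrow> real. (t, t n * a))"
        by (auto intro!: continuous_intros continuous_on_product_coordinates)
      from continuous_map_compose[OF this add] show ?thesis
        by (simp add: comp_def S'_def[abs_def])
    qed
    ultimately show "\<exists>S'. P (Suc n) S' \<and> R n S S'"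
      using a(1) by (intro exI[of _ S']) (auto simp: P_def R_def S'_def[abs_def])
  qed
  then obtain S where S: "\<And>n. P n (S n)" and step: "\<And>n. R n (S n) (S (Suc n))"
    by blast
  obtain a where a: "\<And>n. 0 < a n" and rec: "\<And>n. S (Suc n) = (\<lambda>t. S n t + (t n * a n) *\<^sub>R g n)"
    using step unfolding R_def by metis
  have S_sum: "S N t = (\<Sum>n<N. (t n * a n) *\<^sub>R g n)" for N t
    using S[of 0] by (induction N) (auto simp: P_def rec)
  have S_cont: "continuous_map euclidean mtopology (S n)" for n
    using S[of n] by (simp add: P_def)
  then have S_V: "S n t \<in> V" for n t
    by (force simp: continuous_map_def)
  \<comment> \<open>The right-hand side is the geometric sum of the step bounds from \<open>m\<close> to \<open>m + k - 1\<close>.\<close>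
  have tail: "d (S m t) (S (m + k) t) \<le> 2 * (1/2) ^ m - 2 * (1/2) ^ (m + k)" if "t \<in> Q" for t m k
  proof (induction k)
    case 0
    then show ?case using S_V by simp
  next
    case (Suc k)
    have "d (S (m + k) t) (S (m + Suc k) t) < (1/2) ^ (m + k)"
      using step[of "m + k"] that by (simp add: R_def)
    then show ?case
      using Suc triangle[of "S m t" "S (m + k) t" "S (m + Suc k) t"] S_V by simp
  qed
  define clamp where "clamp t = (\<lambda>i. max 0 (min 1 (t i)))" for t :: "nat \<Rightarrow> real"
  have clamp_Q: "clamp t \<in> Q" for t by (auto simp: clamp_def Q_def)
  have clamp_id: "clamp t = t" if "t \<in> Q" for t
    using that by (auto simp: clamp_def Q_def fun_eq_iff max_def min_def intro: antisym)
  have clamp_cont: "continuous_map euclidean euclidean clamp"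
    unfolding clamp_def
    by (auto intro!: continuous_on_coordinatewise_then_product continuous_intros continuous_on_product_coordinates)
  have "\<exists>\<Phi>. continuous_map euclidean mtopology \<Phi> \<and>
      (\<forall>e>0. \<forall>\<^sub>F n in sequentially. \<forall>t. d (S n (clamp t)) (\<Phi> t) < e)"
  proof (rule continuous_map_uniformly_Cauchy_limit[OF complete, of euclidean "\<lambda>n. S n \<circ> clamp"])
    show "\<forall>\<^sub>F n in sequentially. continuous_map euclidean mtopology (S n \<circ> clamp)"
      by (intro always_eventually allI continuous_map_compose[OF clamp_cont S_cont])
    fix e :: real assume "0 < e"
    then obtain N :: nat where N: "(1/2) ^ N < e / 2"
      using real_arch_pow_inv[of "e / 2" "1 / 2"] by auto
    have le: "d (S m t) (S n t) < e" if "t \<in> Q" "N \<le> m" "m \<le> n" for m n t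
    proof -
      have "d (S m t) (S n t) \<le> 2 * (1/2) ^ m"
        using tail[OF that(1), of m "n - m"] that(3) zero_le_power[of "1/2::real" n]
        by (simp del: zero_le_power)
      also have "\<dots> \<le> 2 * (1/2) ^ N"
        using power_decreasing[OF that(2), of "1/2::real"] by simp
      also have "\<dots> < e" using N by simp
      finally show ?thesis .
    qed
    show "\<exists>N. \<forall>m n t. N \<le> m \<longrightarrow> N \<le> n \<longrightarrow> t \<in> topspace euclidean \<longrightarrow>
        d ((S m \<circ> clamp) t) ((S n \<circ> clamp) t) < e"
    proof (intro exI[of _ N] allI impI)
      fix m n t assume "N \<le> m" "N \<le> n"
      then show "d ((S m \<circ> clamp) t) ((S n \<circ> clamp) t) < e"
        using le[OF clamp_Q, of m n t] le[OF clamp_Q, of n m t]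
        by (cases "m \<le> n") (auto simp: commute)
    qed
  qed auto
  then obtain \<Phi> where \<Phi>: "continuous_map euclidean mtopology \<Phi>"
    and unif: "\<And>e. 0 < e \<Longrightarrow> \<forall>\<^sub>F n in sequentially. \<forall>t. d (S n (clamp t)) (\<Phi> t) < e"
    by blast
  have \<Phi>_V: "\<Phi> t \<in> V" for t
    using \<Phi> by (auto simp: continuous_map_def)
  have lim: "limitin mtopology (\<lambda>n. S n (clamp t)) (\<Phi> t) sequentially" for t
    unfolding limitin_metric
  proof (intro conjI allI impI \<Phi>_V)
    fix e :: real assume "0 < e"
    from unif[OF this] show "\<forall>\<^sub>F n in sequentially. S n (clamp t) \<in> V \<and> d (S n (clamp t)) (\<Phi> t) < e"
      by (rule eventually_mono) (simp add: S_V)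
  qed
  have "\<Phi> (clamp t) = \<Phi> t" for t
    using limitin_metric_unique[OF lim[of "clamp t"], of "\<Phi> t"] lim[of t] clamp_id[OF clamp_Q, of t]
    by simp
  then have "range \<Phi> = \<Phi> ` Q"
    using clamp_Q by (metis (no_types, opaque_lifting) image_eqI image_subsetI rangeE rangeI subset_antisym)
  moreover have "compactin mtopology (\<Phi> ` Q)"
    using compact_unit_cube by (intro image_compactin[OF _ \<Phi>]) (simp add: Q_def)
  ultimately have "compactin mtopology (range \<Phi>)" by simp
  moreover have "limitin mtopology (\<lambda>N. \<Sum>n<N. (t n * a n) *\<^sub>R g n) (\<Phi> t) sequentially"
    if "\<forall>i. t i \<in> {0..1}" for t
    using lim[of t] clamp_id[of t] that by (simp add: Q_def S_sum)
  ultimately show ?thesis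
    using a \<Phi> by blast
qed

section \<open>Prevalence\<close>

text \<open>
Fubini in one coordinate: the product measure is the image of the product of its \<open>n\<close>-th factor with the
remaining ones, and countable sets are null for the uniform distribution.
\<close>

lemma AE_product_avoid_countable_sections:
  fixes E :: "(nat \<Rightarrow> real) set"
  assumes E: "E \<in> sets borel" and sections: "\<And>t. countable {\<sigma>\<in>{0..1}. t(n := \<sigma>) \<in> E}"
  shows "AE t in (\<Pi>\<^sub>M i\<in>UNIV. uniform_measure lborel {0..1}). t \<notin> E"
proof -
  define U :: "real measure" where "U = uniform_measure lborel {0..1}"
  have U: "prob_space U"
    unfolding U_def by (rule prob_space_uniform_measure) auto
  have sets_U [measurable_cong]: "sets U = sets borel"
    by (simp add: U_def)
  interpret U: prob_space U by fact
  interpret R: prob_space "PiM (UNIV - {n}) (\<lambda>_. U)"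
    by (rule prob_space_PiM) (rule U)
  interpret pair_prob_space U "PiM (UNIV - {n}) (\<lambda>_. U)" ..
  have [measurable]: "E \<in> sets (PiM UNIV (\<lambda>_. U))"
  proof -
    have "sets (PiM UNIV (\<lambda>_. U)) = sets (PiM UNIV (\<lambda>_::nat. borel :: real measure))"
      by (rule sets_PiM_cong) (auto simp: sets_U)
    then show ?thesis
      using E by (simp add: sets_PiM_equal_borel)
  qed
  have upd [measurable]: "(\<lambda>(\<sigma>, t). t(n := \<sigma>))
      \<in> U \<Otimes>\<^sub>M PiM (UNIV - {n}) (\<lambda>_. U) \<rightarrow>\<^sub>M PiM UNIV (\<lambda>_. U)"
  proof -
    have "(\<lambda>x. (snd x)(n := fst x))
        \<in> U \<Otimes>\<^sub>M PiM (UNIV - {n}) (\<lambda>_. U) \<rightarrow>\<^sub>M PiM UNIV (\<lambda>_. U)"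
      by (rule measurable_fun_upd[where J = "UNIV - {n}"]) auto
    then show ?thesis by (simp add: case_prod_beta)
  qed
  have not_E: "{x \<in> space (U \<Otimes>\<^sub>M PiM (UNIV - {n}) (\<lambda>_. U)). (case x of (\<sigma>, t) \<Rightarrow> t(n := \<sigma>)) \<notin> E}
      \<in> sets (U \<Otimes>\<^sub>M PiM (UNIV - {n}) (\<lambda>_. U))"
    by (rule measurable_sets_Collect[OF upd]) simp
  have eq: "PiM UNIV (\<lambda>_. U)
    = distr (U \<Otimes>\<^sub>M PiM (UNIV - {n}) (\<lambda>_. U)) (PiM UNIV (\<lambda>_. U)) (\<lambda>(\<sigma>, t). t(n := \<sigma>))"
    using distr_pair_PiM_eq_PiM[of "UNIV - {n}" "\<lambda>_. U" n] U by (simp add: insert_absorb)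
  have "AE t in PiM (UNIV - {n}) (\<lambda>_. U). AE \<sigma> in U. t(n := \<sigma>) \<notin> E"
  proof (rule AE_I2)
    fix t
    have "AE \<sigma> in lborel. \<sigma> \<notin> {\<sigma>\<in>{0..1}. t(n := \<sigma>) \<in> E}"
      by (intro AE_not_in countable_imp_null_set_lborel sections)
    then show "AE \<sigma> in U. t(n := \<sigma>) \<notin> E"
      unfolding U_def by (intro AE_uniform_measureI) (auto elim!: eventually_mono)
  qed
  then have "AE \<sigma> in U. AE t in PiM (UNIV - {n}) (\<lambda>_. U). t(n := \<sigma>) \<notin> E"
    by (subst AE_commute) (use not_E in \<open>simp_all add: case_prod_beta\<close>)
  then have "AE x in U \<Otimes>\<^sub>M PiM (UNIV - {n}) (\<lambda>_. U). (case x of (\<sigma>, t) \<Rightarrow> t(n := \<sigma>)) \<notin> E"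
    by (intro AE_pair_measure not_E) simp
  then have "AE t in PiM UNIV (\<lambda>_. U). t \<notin> E"
    by (subst eq, subst AE_distr_iff[OF upd]) simp_all
  then show ?thesis unfolding U_def .
qed

text \<open>
When only the coordinate \<open>n\<close> of a point of the cube varies, \<open>\<Phi>\<close> runs along a line in direction \<open>h\<close>,
which meets the exceptional set in countably many points. Only the part of that set inside the cube is
considered, where \<open>\<Phi>\<close> is affine in the coordinate; the cube has full measure.
\<close>

lemma AE_affine_family_avoids_nondifferentiable:
  fixes T :: "'a::metric_space \<Rightarrow> 'a" and \<Phi> :: "(nat \<Rightarrow> real) \<Rightarrow> 'a \<Rightarrow>\<^sub>C real"
  assumes compact: "compact (UNIV :: 'a set)" and T: "continuous_on UNIV T"
    and \<Phi>_cont: "continuous_on UNIV \<Phi>"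
    and affine: "\<And>t \<sigma>. \<forall>i. t i \<in> {0..1} \<Longrightarrow> \<sigma> \<in> {0..1} \<Longrightarrow>
      \<Phi> (t(n := \<sigma>)) = \<Phi> (t(n := 0)) + \<sigma> *\<^sub>R h"
  shows "AE t in (\<Pi>\<^sub>M i\<in>UNIV. uniform_measure lborel {0..1}). \<Phi> t - x \<notin> nondifferentiable_along T h"
proof -
  define P :: "(nat \<Rightarrow> real) measure" where "P = PiM UNIV (\<lambda>_. uniform_measure lborel {0..1})"
  let ?E = "nondifferentiable_along T h"
  have meas: "{t. \<Phi> t - x \<in> ?E \<and> (\<forall>i. t i \<in> {0..1})} \<in> sets borel"
  proof -
    have "(\<lambda>t. \<Phi> t - x) -` ?E \<inter> space borel \<in> sets borel"
      by (rule measurable_sets[OF _ sets_nondifferentiable_along[OF compact T]])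
         (intro borel_measurable_continuous_onI continuous_intros \<Phi>_cont)
    moreover have "{t :: nat \<Rightarrow> real. \<forall>i. t i \<in> {0..1}} \<in> sets borel"
      by (intro borel_closed compact_imp_closed compact_unit_cube)
    ultimately have "((\<lambda>t. \<Phi> t - x) -` ?E \<inter> space borel) \<inter> {t. \<forall>i. t i \<in> {0..1}} \<in> sets borel"
      by (rule sets.Int)
    then show ?thesis by (simp add: Int_def vimage_def)
  qed
  have "AE t in P. t \<notin> {t. \<Phi> t - x \<in> ?E \<and> (\<forall>i. t i \<in> {0..1})}"
    unfolding P_def
  proof (rule AE_product_avoid_countable_sections[OF meas])
    fix t
    let ?D = "{\<sigma>\<in>{0..1}. t(n := \<sigma>) \<in> {t. \<Phi> t - x \<in> ?E \<and> (\<forall>i. t i \<in> {0..1})}}"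
    show "countable ?D"
    proof (cases "\<forall>i. i \<noteq> n \<longrightarrow> t i \<in> {0..1}")
      case True
      then have t0: "\<forall>i. (t(n := 0)) i \<in> {0..1}"
        by simp
      have "?D \<subseteq> {\<sigma>. (\<Phi> (t(n := 0)) - x) + \<sigma> *\<^sub>R h \<in> ?E}"
      proof
        fix \<sigma> assume "\<sigma> \<in> ?D"
        then have \<sigma>: "\<sigma> \<in> {0..1}" and D: "\<Phi> (t(n := \<sigma>)) - x \<in> ?E"
          by blast+
        have "\<Phi> (t(n := \<sigma>)) - x = (\<Phi> (t(n := 0)) - x) + \<sigma> *\<^sub>R h"
          using affine[of "t(n := 0)" \<sigma>, OF t0 \<sigma>] by simp
        with D show "\<sigma> \<in> {\<sigma>. (\<Phi> (t(n := 0)) - x) + \<sigma> *\<^sub>R h \<in> ?E}"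
          by (simp only: mem_Collect_eq)
      qed
      then show ?thesis
        by (rule countable_subset) (rule countable_nondifferentiable_on_line[OF compact T])
    next
      case False
      then obtain i where "i \<noteq> n" "t i \<notin> {0..1}"
        by blast
      then have "\<not> (\<forall>i. (t(n := \<sigma>)) i \<in> {0..1})" for \<sigma>
        by (metis fun_upd_other)
      then have "?D = {}" by blast
      then show ?thesis by (simp only: countable_empty)
    qed
  qed
  moreover have "AE t in P. \<forall>i. t i \<in> {0..1}"
    unfolding AE_all_countable
  proof
    fix i
    show "AE t in P. t i \<in> {0..1}"
      unfolding P_def
      by (rule AE_PiM_component) (auto intro!: prob_space_uniform_measure AE_uniform_measureI)
  qed
  ultimately have "AE t in P. \<Phi> t - x \<notin> ?E"
    by eventually_elim auto
  then show ?thesis unfolding P_def .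
qed

text \<open>
Each member of a countable determining family is a uniform limit of functions in \<open>V\<close>, and integrals
against a probability measure pass to uniform limits.
\<close>

lemma determining_sequence_in_dense:
  fixes V :: "('a::metric_space \<Rightarrow>\<^sub>C real) set"
  assumes compact: "compact (UNIV :: 'a set)" and dense: "closure V = UNIV"
  shows "\<exists>g :: nat \<Rightarrow> 'a \<Rightarrow>\<^sub>C real. (\<forall>n. g n \<in> V) \<and> (\<forall>\<mu> \<nu>. prob_space \<mu> \<longrightarrow> sets \<mu> = sets borel \<longrightarrow>
    prob_space \<nu> \<longrightarrow> sets \<nu> = sets borel \<longrightarrow>
    (\<forall>n. (\<integral>x. g n x \<partial>\<mu>) = (\<integral>x. g n x \<partial>\<nu>)) \<longrightarrow> \<mu> = \<nu>)"
proof -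
  obtain \<phi> :: "nat \<Rightarrow> 'a \<Rightarrow>\<^sub>C real"
    where \<phi>: "\<And>\<mu> \<nu>. prob_space \<mu> \<Longrightarrow> sets \<mu> = sets borel \<Longrightarrow> prob_space \<nu> \<Longrightarrow> sets \<nu> = sets borel
      \<Longrightarrow> \<forall>n. (\<integral>x. \<phi> n x \<partial>\<mu>) = (\<integral>x. \<phi> n x \<partial>\<nu>) \<Longrightarrow> \<mu> = \<nu>"
    using countable_determining_functions[OF compact] by blast
  have "\<exists>h\<in>V. dist h (\<phi> n) < 1 / real (Suc k)" for n k
    using dense closure_approachable[of "\<phi> n" V] by auto
  then obtain h where h: "\<And>n k. h n k \<in> V" "\<And>n k. dist (h n k) (\<phi> n) < 1 / real (Suc k)"
    by metis
  define g where "g m = case_prod h (prod_decode m)" for m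
  have "\<mu> = \<nu>"
    if "prob_space \<mu>" "sets \<mu> = sets borel" "prob_space \<nu>" "sets \<nu> = sets borel"
      and eq: "\<forall>n. (\<integral>x. g n x \<partial>\<mu>) = (\<integral>x. g n x \<partial>\<nu>)" for \<mu> \<nu> :: "'a measure"
  proof (rule \<phi>)
    have h_eq: "(\<integral>x. h n k x \<partial>\<mu>) = (\<integral>x. h n k x \<partial>\<nu>)" for n k
      using eq[rule_format, of "prod_encode (n, k)"] by (simp add: g_def)
    have h_lim: "(\<lambda>k. \<integral>x. h n k x \<partial>M) \<longlonglongrightarrow> (\<integral>x. \<phi> n x \<partial>M)"
      if "prob_space M" "sets M = sets borel" for M n
    proof (rule LIM_zero_cancel, rule Lim_null_comparison)
      have "norm ((\<integral>x. h n k x \<partial>M) - (\<integral>x. \<phi> n x \<partial>M)) \<le> 1 / real (Suc k)" for k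
        using abs_integral_bcontfun_diff_le[OF that, of "h n k" "\<phi> n"] h(2)[of n k]
        unfolding real_norm_def by linarith
      then show "\<forall>\<^sub>F k in sequentially. norm ((\<integral>x. h n k x \<partial>M) - (\<integral>x. \<phi> n x \<partial>M)) \<le> 1 / real (Suc k)"
        by (intro always_eventually allI)
      show "(\<lambda>k. 1 / real (Suc k)) \<longlonglongrightarrow> 0"
        by (rule LIMSEQ_Suc[OF lim_const_over_n[of 1]])
    qed
    show "\<forall>n. (\<integral>x. \<phi> n x \<partial>\<mu>) = (\<integral>x. \<phi> n x \<partial>\<nu>)"
    proof
      fix n
      show "(\<integral>x. \<phi> n x \<partial>\<mu>) = (\<integral>x. \<phi> n x \<partial>\<nu>)"
        using h_lim[of \<mu> n] h_lim[of \<nu> n] that unfolding h_eq[of n] by (intro LIMSEQ_unique)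
    qed
  qed (use that in auto)
  moreover have "g m \<in> V" for m
    by (simp add: g_def h(1) split: prod.split)
  ultimately show ?thesis by blast
qed

theorem theorem1:
  fixes T :: "'a::metric_space \<Rightarrow> 'a"
    and V :: "('a \<Rightarrow>\<^sub>C real) set"
    and d :: "('a \<Rightarrow>\<^sub>C real) \<Rightarrow> ('a \<Rightarrow>\<^sub>C real) \<Rightarrow> real"
  defines "\<tau> \<equiv> Metric_space.mtopology V d"
  assumes compact_X: "compact (UNIV :: 'a set)"
    and cont_T: "continuous_on UNIV T"
    and subspace_V: "subspace V"
    and metric: "Metric_space V d"
    and complete: "Metric_space.mcomplete V d"
    and translation: "\<forall>g\<in>V. continuous_map \<tau> \<tau> (\<lambda>f. f + g)"
    and scaling: "continuous_map (prod_topology euclideanreal \<tau>) \<tau> (\<lambda>(c, f). c *\<^sub>R f)"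
    and inclusion: "continuous_map \<tau> euclidean (\<lambda>f. f)"
    and dense: "closure V = UNIV"
  shows "prevalent \<tau> {f \<in> V. is_singleton (maximising_measures T f)}"
proof -
  interpret metrised_subspace V d
    using metric subspace_V translation scaling
    by (simp add: metrised_subspace_def metrised_subspace_axioms_def \<tau>_def)
  have top_\<tau>: "topspace \<tau> = V" by (simp add: \<tau>_def)
  obtain g :: "nat \<Rightarrow> 'a \<Rightarrow>\<^sub>C real" where g_V: "\<And>n. g n \<in> V"
    and determining: "\<And>\<mu> \<nu>. prob_space \<mu> \<Longrightarrow> sets \<mu> = sets borel \<Longrightarrow> prob_space \<nu> \<Longrightarrow> sets \<nu> = sets borel
      \<Longrightarrow> \<forall>n. (\<integral>x. g n x \<partial>\<mu>) = (\<integral>x. g n x \<partial>\<nu>) \<Longrightarrow> \<mu> = \<nu>"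
    using determining_sequence_in_dense[OF compact_X dense] by blast
  from uniformly_convergent_random_series[of g, OF complete g_V, folded \<tau>_def]
  obtain a \<Phi> where a: "\<And>n. 0 < a n" and \<Phi>: "continuous_map euclidean \<tau> \<Phi>"
    and \<Phi>_compact: "compactin \<tau> (range \<Phi>)"
    and \<Phi>_lim: "\<And>t. \<forall>i. t i \<in> {0..1} \<Longrightarrow>
      limitin \<tau> (\<lambda>N. \<Sum>n<N. (t n * a n) *\<^sub>R g n) (\<Phi> t) sequentially"
    by blast
  have \<Phi>_V: "\<Phi> t \<in> V" for t
    using \<Phi> by (auto simp: continuous_map_def top_\<tau>)
  have \<Phi>_cont: "continuous_on UNIV \<Phi>"
    using continuous_map_compose[OF \<Phi> inclusion] by (simp add: comp_def)
  have \<Phi>_sums: "(\<lambda>N. \<Sum>n<N. (t n * a n) *\<^sub>R g n) \<longlonglongrightarrow> \<Phi> t" if "\<forall>i. t i \<in> {0..1}" for t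
    using continuous_map_limit[OF inclusion \<Phi>_lim[OF that]] by (simp add: comp_def)
  \<comment> \<open>Changing the coordinate \<open>n\<close> changes every partial sum beyond \<open>n\<close> by the same vector.\<close>
  have affine: "\<Phi> (t(n := \<sigma>)) = \<Phi> (t(n := 0)) + \<sigma> *\<^sub>R (a n *\<^sub>R g n)"
    if t: "\<forall>i. t i \<in> {0..1}" and \<sigma>: "\<sigma> \<in> {0..1}" for t n \<sigma>
  proof -
    let ?S = "\<lambda>t N. \<Sum>n<N. (t n * a n) *\<^sub>R g n"
    have S_upd: "?S (t(n := \<sigma>)) N = ?S (t(n := 0)) N + \<sigma> *\<^sub>R (a n *\<^sub>R g n)" if "n < N" for N
    proof -
      have "?S (t(n := s)) N = (s * a n) *\<^sub>R g n + (\<Sum>i\<in>{..<N} - {n}. (t i * a i) *\<^sub>R g i)" for s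
        using \<open>n < N\<close> by (subst sum.remove[of _ n]) auto
      then show ?thesis by simp
    qed
    have "(\<lambda>N. ?S (t(n := 0)) N + \<sigma> *\<^sub>R (a n *\<^sub>R g n)) \<longlonglongrightarrow> \<Phi> (t(n := 0)) + \<sigma> *\<^sub>R (a n *\<^sub>R g n)"
      by (intro tendsto_add \<Phi>_sums tendsto_const) (use t in auto)
    moreover have "\<forall>\<^sub>F N in sequentially. ?S (t(n := 0)) N + \<sigma> *\<^sub>R (a n *\<^sub>R g n) = ?S (t(n := \<sigma>)) N"
      using eventually_gt_at_top[of n] by eventually_elim (rule S_upd[symmetric])
    ultimately have "?S (t(n := \<sigma>)) \<longlonglongrightarrow> \<Phi> (t(n := 0)) + \<sigma> *\<^sub>R (a n *\<^sub>R g n)"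
      by (rule Lim_transform_eventually)
    moreover have "?S (t(n := \<sigma>)) \<longlonglongrightarrow> \<Phi> (t(n := \<sigma>))"
      by (rule \<Phi>_sums) (use t \<sigma> in auto)
    ultimately show ?thesis
      using LIMSEQ_unique by blast
  qed
  define P :: "(nat \<Rightarrow> real) measure" where "P = PiM UNIV (\<lambda>_. uniform_measure lborel {0..1})"
  interpret P: prob_space P
    unfolding P_def by (intro prob_space_PiM prob_space_uniform_measure) auto
  have sets_P: "sets P = sets borel"
  proof -
    have "sets P = sets (PiM UNIV (\<lambda>_::nat. borel :: real measure))"
      unfolding P_def by (rule sets_PiM_cong) auto
    then show ?thesis by (simp add: sets_PiM_equal_borel)
  qed
  have space_P: "space P = UNIV"
    using sets_eq_imp_space_eq[OF sets_P] by simp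
  define B where "B = sigma (topspace \<tau>) {U. openin \<tau> U}"
  have opens: "{U. openin \<tau> U} \<subseteq> Pow (topspace \<tau>)"
    by (auto dest: openin_subset)
  have space_B: "space B = V" and sets_B: "sets B = sigma_sets V {U. openin \<tau> U}"
    unfolding B_def using opens by (simp_all add: space_measure_of sets_measure_of top_\<tau>)
  have open_B: "U \<in> sets B" if "openin \<tau> U" for U
    using that by (auto simp: sets_B)
  have \<Phi>_meas [measurable]: "\<Phi> \<in> P \<rightarrow>\<^sub>M B"
    unfolding B_def
  proof (rule measurable_sigma_sets[OF _ opens])
    show "sets (sigma (topspace \<tau>) {U. openin \<tau> U}) = sigma_sets (topspace \<tau>) {U. openin \<tau> U}"
      using opens by (rule sets_measure_of)
    show "\<Phi> \<in> space P \<rightarrow> topspace \<tau>"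
      using \<Phi>_V by (auto simp: top_\<tau>)
    show "\<Phi> -` U \<inter> space P \<in> sets P" if "U \<in> {U. openin \<tau> U}" for U
      using openin_continuous_map_preimage[OF \<Phi>, of U] that
      by (simp add: sets_P space_P vimage_def)
  qed
  define m where "m = distr P B \<Phi>"
  have avoid: "AE y in m. \<forall>n. y - x \<notin> nondifferentiable_along T (a n *\<^sub>R g n)" if x: "x \<in> V" for x
  proof -
    note E_sets = sets_nondifferentiable_along[OF compact_X cont_T]
    have diff_meas: "(\<lambda>y. y - x) \<in> B \<rightarrow>\<^sub>M borel"
    proof (rule borel_measurableI)
      fix S :: "('a \<Rightarrow>\<^sub>C real) set" assume S: "open S"
      have "continuous_map \<tau> euclidean (\<lambda>y. y - x)"
        using continuous_map_compose[OF inclusion, of euclidean "\<lambda>y. y - x"]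
        by (simp add: comp_def continuous_intros)
      from openin_continuous_map_preimage[OF this, of S] S
      show "(\<lambda>y. y - x) -` S \<inter> space B \<in> sets B"
        by (auto intro!: open_B simp: top_\<tau> space_B vimage_def Int_def conj_commute)
    qed
    have "AE t in P. \<Phi> t - x \<notin> nondifferentiable_along T (a n *\<^sub>R g n)" for n
      unfolding P_def
      by (rule AE_affine_family_avoids_nondifferentiable[OF compact_X cont_T \<Phi>_cont affine])
    then have "AE t in P. \<forall>n. \<Phi> t - x \<notin> nondifferentiable_along T (a n *\<^sub>R g n)"
      by (simp add: AE_all_countable)
    moreover have "{y \<in> space B. \<forall>n. y - x \<notin> nondifferentiable_along T (a n *\<^sub>R g n)} \<in> sets B"
    proof -
      have "{y \<in> space B. y - x \<notin> nondifferentiable_along T (a n *\<^sub>R g n)} \<in> sets B" for n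
        using measurable_sets[OF diff_meas, of "- nondifferentiable_along T (a n *\<^sub>R g n)"]
          sets.compl_sets[OF E_sets[of "a n *\<^sub>R g n"]]
        by (simp add: Compl_eq_Diff_UNIV vimage_def Int_def conj_commute)
      then show ?thesis by (rule sets.sets_Collect_countable_All)
    qed
    ultimately show ?thesis
      unfolding m_def by (subst AE_distr_iff) auto
  qed
  have unique: "is_singleton (maximising_measures T f)"
    if f: "\<forall>n. f \<notin> nondifferentiable_along T (a n *\<^sub>R g n)" for f
  proof -
    have "\<mu> = \<nu>" if \<mu>: "\<mu> \<in> maximising_measures T f" and \<nu>: "\<nu> \<in> maximising_measures T f" for \<mu> \<nu>
    proof -
      have inv: "\<mu> \<in> invariant_measures T" "\<nu> \<in> invariant_measures T"
        using \<mu> \<nu> by (auto simp: maximising_measures_def)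
      have "(\<integral>x. g n x \<partial>\<mu>) = (\<integral>x. g n x \<partial>\<nu>)" for n
        using maximising_integral_unique[OF \<mu> \<nu>, of "a n *\<^sub>R g n"] f a[of n] by simp
      then show ?thesis
        by (intro determining invariant_measuresD[OF inv(1)] invariant_measuresD[OF inv(2)]) blast
    qed
    then show ?thesis
      using maximising_measures_nonempty[OF compact_X cont_T, of f]
      unfolding is_singleton_def by blast
  qed
  show ?thesis
    unfolding prevalent_def
  proof (intro conjI exI[of _ m] ballI)
    show "{f \<in> V. is_singleton (maximising_measures T f)} \<subseteq> topspace \<tau>"
      by (auto simp: top_\<tau>)
    show "prob_space m"
      unfolding m_def by (rule P.prob_space_distr) (rule \<Phi>_meas)
    show "space m = topspace \<tau>" by (simp add: m_def space_B top_\<tau>)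
    show "sets m = sets (sigma (topspace \<tau>) {U. openin \<tau> U})" by (simp add: m_def B_def)
    show "\<exists>K. compactin \<tau> K \<and> emeasure m K = 1"
    proof (intro exI[of _ "range \<Phi>"] conjI \<Phi>_compact)
      have "Hausdorff_space \<tau>"
        unfolding \<tau>_def by (rule Hausdorff_space_mtopology)
      then have "closedin \<tau> (range \<Phi>)"
        by (rule compactin_imp_closedin[OF _ \<Phi>_compact])
      then have "openin \<tau> (V - range \<Phi>)"
        by (simp add: closedin_def top_\<tau>)
      then have "space B - (V - range \<Phi>) \<in> sets B"
        by (intro sets.compl_sets open_B)
      moreover have "space B - (V - range \<Phi>) = range \<Phi>"
        using \<Phi>_V by (auto simp: space_B)
      ultimately have "emeasure m (range \<Phi>) = emeasure P (\<Phi> -` range \<Phi> \<inter> space P)"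
        unfolding m_def by (intro emeasure_distr \<Phi>_meas) simp
      also have "\<Phi> -` range \<Phi> \<inter> space P = space P" by auto
      finally show "emeasure m (range \<Phi>) = 1" by (simp add: P.emeasure_space_1)
    qed
    fix x assume "x \<in> topspace \<tau>"
    then have x: "x \<in> V" by (simp add: top_\<tau>)
    have "AE y in m. y \<in> V"
      by (rule AE_I2) (simp add: m_def space_B)
    with avoid[OF x] show "AE y in m. y \<in> (+) x ` {f \<in> V. is_singleton (maximising_measures T f)}"
    proof eventually_elim
      case (elim y)
      then show ?case
        using unique[of "y - x"] subspace_diff[OF subspace_V _ x, of y]
        by (intro image_eqI[of _ _ "y - x"]) auto
    qed
  qed
qed

end
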